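(* For every $\mathcal M\in K_0(gdg\text{-}cat)$ (in particular, for the class of a geometric dg category $\mathcal M$), $$Z_{cat}(\mathcal M,t)=\prod_{n=1}^{\infty}\left(\frac{1}{1-t^n}\right)^{[\mathcal M]},$$ where the powers are taken with respect to the power structure on $K_0(gdg\text{-}cat)$ induced by the categorical zeta function.
   Context: Fix a base field $k$ of characteristic zero; all varieties are over $k$. **Power structures from pre-$\lambda$-structures.** A pre-$\lambda$-ring structure on a commutative unital ring $R$ is a map $R\to 1+tR[[t]]$, $a\mapsto\lambda_a(t)$, with $\lambda_{a+b}(t)=\lambda_a(t)\lambda_b(t)$ and $\lambda_a(t)=1+at+\cdots$. Every $A(t)\in 1+tR[[t]]$ can be written uniquely as $A(t)=\prod_{i\ge1}\lambda_{r_i}(t^i)$ with $r_i\in R$. The induced power structure is $(A(t),m)\mapsto (A(t))^m:=\prod_{i\ge1}\lambda_{mr_i}(t^i)$. **The ring $K_0(gdg\text{-}cat)$.** A pretriangulated dg category is geometric if it is a dg enhancement of a semiorthogonal summand in $D^b_{coh}(X)$ for some smooth projective variety $X$. $K_0(gdg\text{-}cat)$ is the free abelian group on quasi-equivalence classes of geometric pretriangulated dg categories $\mathcal V$ modulo the relations $[\mathcal V]=[\mathcal A]+[\mathcal B]$ whenever $\mathcal A,\mathcal B\subset\mathcal V$ are dg subcategories such that $H^0(\mathcal A),H^0(\mathcal B)$ are admissible subcategories of $H^0(\mathcal V)$ and $H^0(\mathcal V)=\langle H^0(\mathcal A),H^0(\mathcal B)\rangle$ is a semiorthogonal decomposition.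 The product is induced by the completed tensor product $\mathcal M_1\boxtimes\mathcal M_2$ (the dg category of perfect dg modules over $\mathcal M_1\otimes\mathcal M_2$). For geometric $\mathcal V$, $\mathrm{Sym}^n(\mathcal V)$ is the category of $S_n$-equivariant objects in the $n$-th completed tensor power of $\mathcal V$, where $S_n$ permutes the tensor factors: an equivariant object is an object $A$ with isomorphisms $\epsilon_g\colon A\to\rho(g)A$, $g\in S_n$, compatible with the group law, and morphisms are those commuting with the $\epsilon_g$. It is known that these operations descend to operations $\mathrm{Sym}^n$ on $K_0(gdg\text{-}cat)$ defining a 2-$\lambda$-ring structure: $\mathrm{Sym}^0(m)=1$, $\mathrm{Sym}^1(m)=m$, $\mathrm{Sym}^k(m+n)=\sum_{l=0}^k\mathrm{Sym}^l(m)\mathrm{Sym}^{k-l}(n)$, and $\mathrm{Sym}^k(1)=p(k)$, the number of partitions of $k$ ($p(0)=1$). The categorical zeta function is $Z_{cat}(\mathcal M,t)=\sum_{k\ge0}[\mathrm{Sym}^k(\mathcal M)]t^k$; it is a pre-$\lambda$-structure $\lambda_{\mathcal M}(t)=Z_{cat}(\mathcal M,t)$, and the power structure on $K_0(gdg\text{-}cat)$ is the one induced by it. *)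

theory Defs
  imports
    "HOL.Vector_Spaces"
    "HOL-Library.Function_Algebras"
    "HOL-Library.Poly_Mapping"
    "HOL-Library.Multiset"
    "HOL-Combinatorics.Permutations"
    "HOL-Algebra.Free_Abelian_Groups"
    "HOL-Algebra.Ideal"
begin

section \<open>Differential graded categories\<close>

text \<open>
  The base field of characteristic zero is a type \<open>'k\<close>. All Hom-spaces of a dg category are
  linear subspaces of one ambient \<open>'k\<close>-vector space \<open>'m\<close>; subspaces belonging to different
  pairs of objects or different degrees may overlap, which is why the operations carry the
  objects and degrees as arguments. \<open>dgComp A x y z m n g f\<close> is the composite of
  \<open>f : x \<rightarrow> y\<close> of degree \<open>m\<close> with \<open>g : y \<rightarrow> z\<close> of degree \<open>n\<close>.
\<close>

record ('o, 'm, 'k) dgcat =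
  dgObj :: "'o set"
  dgHom :: "'o \<Rightarrow> 'o \<Rightarrow> int \<Rightarrow> 'm set"
  dgScl :: "'k \<Rightarrow> 'm \<Rightarrow> 'm"
  dgDif :: "'o \<Rightarrow> 'o \<Rightarrow> int \<Rightarrow> 'm \<Rightarrow> 'm"
  dgComp :: "'o \<Rightarrow> 'o \<Rightarrow> 'o \<Rightarrow> int \<Rightarrow> int \<Rightarrow> 'm \<Rightarrow> 'm \<Rightarrow> 'm"
  dgId :: "'o \<Rightarrow> 'm"

definition linear_between ::
  "('k \<Rightarrow> 'v \<Rightarrow> 'v::ab_group_add) \<Rightarrow> 'v set \<Rightarrow> ('k \<Rightarrow> 'w \<Rightarrow> 'w::ab_group_add) \<Rightarrow> 'w set
    \<Rightarrow> ('v \<Rightarrow> 'w) \<Rightarrow> bool" where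
  "linear_between s V t W f \<longleftrightarrow>
     (\<forall>v\<in>V. f v \<in> W) \<and> (\<forall>u\<in>V. \<forall>v\<in>V. f (u + v) = f u + f v) \<and> (\<forall>c. \<forall>v\<in>V. f (s c v) = t c (f v))"

definition sg :: "int \<Rightarrow> 'v::ab_group_add \<Rightarrow> 'v" where
  "sg n v = (if even n then v else - v)"

definition dg_category :: "('o, 'm::ab_group_add, 'k::field) dgcat \<Rightarrow> bool" where
  "dg_category A \<longleftrightarrow>
     vector_space (dgScl A) \<and>
     (\<forall>x\<in>dgObj A. \<forall>y\<in>dgObj A. \<forall>n. module.subspace (dgScl A) (dgHom A x y n)) \<and>
     (\<forall>x\<in>dgObj A. \<forall>y\<in>dgObj A. \<forall>n.
        linear_between (dgScl A) (dgHom A x y n) (dgScl A) (dgHom A x y (n + 1)) (dgDif A x y n) \<and>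
        (\<forall>f\<in>dgHom A x y n. dgDif A x y (n + 1) (dgDif A x y n f) = 0)) \<and>
     (\<forall>x\<in>dgObj A. \<forall>y\<in>dgObj A. \<forall>z\<in>dgObj A. \<forall>m n.
        (\<forall>g\<in>dgHom A y z n.
           linear_between (dgScl A) (dgHom A x y m) (dgScl A) (dgHom A x z (m + n))
             (\<lambda>f. dgComp A x y z m n g f)) \<and>
        (\<forall>f\<in>dgHom A x y m.
           linear_between (dgScl A) (dgHom A y z n) (dgScl A) (dgHom A x z (m + n))
             (\<lambda>g. dgComp A x y z m n g f)) \<and>
        (\<forall>f\<in>dgHom A x y m. \<forall>g\<in>dgHom A y z n.
           dgDif A x z (m + n) (dgComp A x y z m n g f) =
             dgComp A x y z m (n + 1) (dgDif A y z n g) f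
             + sg n (dgComp A x y z (m + 1) n g (dgDif A x y m f)))) \<and>
     (\<forall>w\<in>dgObj A. \<forall>x\<in>dgObj A. \<forall>y\<in>dgObj A. \<forall>z\<in>dgObj A. \<forall>l m n.
        \<forall>f\<in>dgHom A w x l. \<forall>g\<in>dgHom A x y m. \<forall>h\<in>dgHom A y z n.
          dgComp A w y z (l + m) n h (dgComp A w x y l m g f) =
          dgComp A w x z l (m + n) (dgComp A x y z m n h g) f) \<and>
     (\<forall>x\<in>dgObj A. dgId A x \<in> dgHom A x x 0) \<and>
     (\<forall>x\<in>dgObj A. \<forall>y\<in>dgObj A. \<forall>n. \<forall>f\<in>dgHom A x y n.
        dgComp A x y y n 0 (dgId A y) f = f \<and> dgComp A x x y 0 n f (dgId A x) = f)"

definition dg_full :: "('o, 'm, 'k) dgcat \<Rightarrow> 'o set \<Rightarrow> ('o, 'm, 'k) dgcat" where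
  "dg_full A S = A\<lparr>dgObj := S\<rparr>"

definition dgZ :: "('o, 'm::ab_group_add, 'k) dgcat \<Rightarrow> 'o \<Rightarrow> 'o \<Rightarrow> int \<Rightarrow> 'm set" where
  "dgZ A x y n = {f \<in> dgHom A x y n. dgDif A x y n f = 0}"

definition dgB :: "('o, 'm::ab_group_add, 'k) dgcat \<Rightarrow> 'o \<Rightarrow> 'o \<Rightarrow> int \<Rightarrow> 'm set" where
  "dgB A x y n = dgDif A x y (n - 1) ` dgHom A x y (n - 1)"

definition homotopic :: "('o, 'm::ab_group_add, 'k) dgcat \<Rightarrow> 'o \<Rightarrow> 'o \<Rightarrow> int \<Rightarrow> 'm \<Rightarrow> 'm \<Rightarrow> bool" where
  "homotopic A x y n f g \<longleftrightarrow> f - g \<in> dgB A x y n"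

definition homotopy_equivalence :: "('o, 'm::ab_group_add, 'k) dgcat \<Rightarrow> 'o \<Rightarrow> 'o \<Rightarrow> 'm \<Rightarrow> bool" where
  "homotopy_equivalence A x y f \<longleftrightarrow>
     x \<in> dgObj A \<and> y \<in> dgObj A \<and> f \<in> dgZ A x y 0 \<and>
     (\<exists>g\<in>dgZ A y x 0. homotopic A x x 0 (dgComp A x y x 0 0 g f) (dgId A x) \<and>
                      homotopic A y y 0 (dgComp A y x y 0 0 f g) (dgId A y))"

text \<open>A closed degree 0 isomorphism (not merely a homotopy equivalence).\<close>

definition strict_iso :: "('o, 'm::ab_group_add, 'k) dgcat \<Rightarrow> 'o \<Rightarrow> 'o \<Rightarrow> 'm \<Rightarrow> bool" where
  "strict_iso A x y f \<longleftrightarrow>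
     f \<in> dgZ A x y 0 \<and>
     (\<exists>g\<in>dgZ A y x 0. dgComp A x y x 0 0 g f = dgId A x \<and> dgComp A y x y 0 0 f g = dgId A y)"

definition dg_functor ::
  "('o, 'm::ab_group_add, 'k::field) dgcat \<Rightarrow> ('p, 'n::ab_group_add, 'k) dgcat
    \<Rightarrow> ('o \<Rightarrow> 'p) \<Rightarrow> ('o \<Rightarrow> 'o \<Rightarrow> int \<Rightarrow> 'm \<Rightarrow> 'n) \<Rightarrow> bool" where
  "dg_functor A B F \<Phi> \<longleftrightarrow>
     (\<forall>x\<in>dgObj A. F x \<in> dgObj B \<and> \<Phi> x x 0 (dgId A x) = dgId B (F x)) \<and>
     (\<forall>x\<in>dgObj A. \<forall>y\<in>dgObj A. \<forall>n.
        linear_between (dgScl A) (dgHom A x y n) (dgScl B) (dgHom B (F x) (F y) n) (\<Phi> x y n) \<and>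
        (\<forall>f\<in>dgHom A x y n. \<Phi> x y (n + 1) (dgDif A x y n f) = dgDif B (F x) (F y) n (\<Phi> x y n f))) \<and>
     (\<forall>x\<in>dgObj A. \<forall>y\<in>dgObj A. \<forall>z\<in>dgObj A. \<forall>m n. \<forall>f\<in>dgHom A x y m. \<forall>g\<in>dgHom A y z n.
        \<Phi> x z (m + n) (dgComp A x y z m n g f) =
        dgComp B (F x) (F y) (F z) m n (\<Phi> y z n g) (\<Phi> x y m f))"

definition quasi_equivalence ::
  "('o, 'm::ab_group_add, 'k::field) dgcat \<Rightarrow> ('p, 'n::ab_group_add, 'k) dgcat
    \<Rightarrow> ('o \<Rightarrow> 'p) \<Rightarrow> ('o \<Rightarrow> 'o \<Rightarrow> int \<Rightarrow> 'm \<Rightarrow> 'n) \<Rightarrow> bool" where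
  "quasi_equivalence A B F \<Phi> \<longleftrightarrow>
     dg_functor A B F \<Phi> \<and>
     (\<forall>x\<in>dgObj A. \<forall>y\<in>dgObj A. \<forall>n.
        (\<forall>f\<in>dgZ A x y n. \<Phi> x y n f \<in> dgB B (F x) (F y) n \<longrightarrow> f \<in> dgB A x y n) \<and>
        (\<forall>g\<in>dgZ B (F x) (F y) n. \<exists>f\<in>dgZ A x y n. homotopic B (F x) (F y) n g (\<Phi> x y n f))) \<and>
     (\<forall>y\<in>dgObj B. \<exists>x\<in>dgObj A. \<exists>f. homotopy_equivalence B (F x) y f)"

text \<open>
  \<open>dg_shift A x y\<close>: \<open>y\<close> is the shift \<open>x[1]\<close>. \<open>dg_cone A x y z f i p\<close>: \<open>z\<close> is the cone of the closed
  degree 0 morphism \<open>f : x \<rightarrow> y\<close>, i.e. \<open>z = y \<oplus> x[1]\<close> as graded objects, with inclusions \<open>i, j\<close> and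
  projections \<open>q, p\<close>, and the differential of \<open>z\<close> is twisted by \<open>f\<close>; the cone triangle is
  \<open>x \<rightarrow> y \<rightarrow> z \<rightarrow> x[1]\<close> with maps \<open>f, i, p\<close>, where \<open>p : z \<rightarrow> x\<close> has degree 1.
\<close>

definition dg_shift :: "('o, 'm::ab_group_add, 'k) dgcat \<Rightarrow> 'o \<Rightarrow> 'o \<Rightarrow> bool" where
  "dg_shift A x y \<longleftrightarrow>
     x \<in> dgObj A \<and> y \<in> dgObj A \<and>
     (\<exists>u\<in>dgZ A x y (-1). \<exists>v\<in>dgZ A y x 1.
        dgComp A x y x (-1) 1 v u = dgId A x \<and> dgComp A y x y 1 (-1) u v = dgId A y)"

definition dg_cone ::
  "('o, 'm::ab_group_add, 'k) dgcat \<Rightarrow> 'o \<Rightarrow> 'o \<Rightarrow> 'o \<Rightarrow> 'm \<Rightarrow> 'm \<Rightarrow> 'm \<Rightarrow> bool" where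
  "dg_cone A x y z f i p \<longleftrightarrow>
     x \<in> dgObj A \<and> y \<in> dgObj A \<and> z \<in> dgObj A \<and>
     f \<in> dgZ A x y 0 \<and> i \<in> dgZ A y z 0 \<and> p \<in> dgZ A z x 1 \<and>
     (\<exists>j\<in>dgHom A x z (-1). \<exists>q\<in>dgHom A z y 0.
        dgComp A y z y 0 0 q i = dgId A y \<and>
        dgComp A x z x (-1) 1 p j = dgId A x \<and>
        dgComp A x z y (-1) 0 q j = 0 \<and>
        dgComp A y z x 0 1 p i = 0 \<and>
        dgComp A z x z 1 (-1) j p + dgComp A z y z 0 0 i q = dgId A z \<and>
        dgDif A x z (-1) j = dgComp A x y z 0 0 i f \<and>
        dgDif A z y 0 q = - dgComp A z x y 1 0 f p)"


section \<open>Dg modules and perfect dg modules\<close>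

text \<open>
  A right dg module over \<open>A\<close>, i.e. a dg functor from the opposite of \<open>A\<close> to complexes of vector
  spaces; \<open>mAct M x y m n a u\<close> is \<open>a \<cdot> u\<close> for \<open>a \<in> M(x)\<close> of degree \<open>m\<close> and \<open>u : y \<rightarrow> x\<close> of degree \<open>n\<close>.
\<close>

record ('o, 'm) dgmod =
  mSp :: "'o \<Rightarrow> int \<Rightarrow> 'm set"
  mDif :: "'o \<Rightarrow> int \<Rightarrow> 'm \<Rightarrow> 'm"
  mAct :: "'o \<Rightarrow> 'o \<Rightarrow> int \<Rightarrow> int \<Rightarrow> 'm \<Rightarrow> 'm \<Rightarrow> 'm"

definition dg_module :: "('o, 'm::ab_group_add, 'k::field) dgcat \<Rightarrow> ('o, 'm) dgmod \<Rightarrow> bool" where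
  "dg_module A M \<longleftrightarrow>
     (\<forall>x\<in>dgObj A. \<forall>m.
        module.subspace (dgScl A) (mSp M x m) \<and>
        linear_between (dgScl A) (mSp M x m) (dgScl A) (mSp M x (m + 1)) (mDif M x m) \<and>
        (\<forall>a\<in>mSp M x m. mDif M x (m + 1) (mDif M x m a) = 0 \<and> mAct M x x m 0 a (dgId A x) = a)) \<and>
     (\<forall>x\<in>dgObj A. \<forall>y\<in>dgObj A. \<forall>m n.
        (\<forall>u\<in>dgHom A y x n.
           linear_between (dgScl A) (mSp M x m) (dgScl A) (mSp M y (m + n)) (\<lambda>a. mAct M x y m n a u)) \<and>
        (\<forall>a\<in>mSp M x m.
           linear_between (dgScl A) (dgHom A y x n) (dgScl A) (mSp M y (m + n)) (mAct M x y m n a)) \<and>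
        (\<forall>a\<in>mSp M x m. \<forall>u\<in>dgHom A y x n.
           mDif M y (m + n) (mAct M x y m n a u) =
             mAct M x y (m + 1) n (mDif M x m a) u + sg m (mAct M x y m (n + 1) a (dgDif A y x n u)))) \<and>
     (\<forall>x\<in>dgObj A. \<forall>y\<in>dgObj A. \<forall>z\<in>dgObj A. \<forall>m n l.
        \<forall>a\<in>mSp M x m. \<forall>u\<in>dgHom A y x n. \<forall>v\<in>dgHom A z y l.
          mAct M y z (m + n) l (mAct M x y m n a u) v =
          mAct M x z m (l + n) a (dgComp A z y x l n u v))"

text \<open>
  The dg category of dg modules. A homogeneous morphism is a family of linear maps, extended by
  zero so that equality of morphisms is equality of functions.
\<close>

definition dg_Mod ::
  "('o, 'm::ab_group_add, 'k::field) dgcat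
    \<Rightarrow> (('o, 'm) dgmod, 'o \<Rightarrow> int \<Rightarrow> 'm \<Rightarrow> 'm, 'k) dgcat" where
  "dg_Mod A =
     \<lparr>dgObj = {M. dg_module A M},
      dgHom = (\<lambda>M N n. {\<phi>.
        (\<forall>x\<in>dgObj A. \<forall>m.
           linear_between (dgScl A) (mSp M x m) (dgScl A) (mSp N x (m + n)) (\<phi> x m)) \<and>
        (\<forall>x m a. x \<notin> dgObj A \<or> a \<notin> mSp M x m \<longrightarrow> \<phi> x m a = 0) \<and>
        (\<forall>x\<in>dgObj A. \<forall>y\<in>dgObj A. \<forall>m l. \<forall>a\<in>mSp M x m. \<forall>u\<in>dgHom A y x l.
           \<phi> y (m + l) (mAct M x y m l a u) = mAct N x y (m + n) l (\<phi> x m a) u)}),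
      dgScl = (\<lambda>c \<phi> x m a. dgScl A c (\<phi> x m a)),
      dgDif = (\<lambda>M N n \<phi> x m a. if x \<in> dgObj A \<and> a \<in> mSp M x m
        then mDif N x (m + n) (\<phi> x m a) - sg n (\<phi> x (m + 1) (mDif M x m a)) else 0),
      dgComp = (\<lambda>M N P k l \<psi> \<phi> x m a. \<psi> x (m + k) (\<phi> x m a)),
      dgId = (\<lambda>M x m a. if x \<in> dgObj A \<and> a \<in> mSp M x m then a else 0)\<rparr>"

definition yoneda :: "('o, 'm, 'k) dgcat \<Rightarrow> 'o \<Rightarrow> ('o, 'm) dgmod" where
  "yoneda A x =
     \<lparr>mSp = (\<lambda>y m. dgHom A y x m),
      mDif = (\<lambda>y m. dgDif A y x m),
      mAct = (\<lambda>y z m n a u. dgComp A z y x n m a u)\<rparr>"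

definition yoneda_map ::
  "('o, 'm::ab_group_add, 'k) dgcat \<Rightarrow> 'o \<Rightarrow> 'o \<Rightarrow> int \<Rightarrow> 'm \<Rightarrow> 'o \<Rightarrow> int \<Rightarrow> 'm \<Rightarrow> 'm" where
  "yoneda_map A x x' n f =
     (\<lambda>y m a. if y \<in> dgObj A \<and> a \<in> dgHom A y x m then dgComp A y x x' m n f a else 0)"

text \<open>
  Perfect modules, in their homotopically projective model: the closure of the representable
  modules under shifts, cones and homotopy direct summands.
\<close>

inductive perfect :: "('o, 'm::ab_group_add, 'k::field) dgcat \<Rightarrow> ('o, 'm) dgmod \<Rightarrow> bool"
  for A :: "('o, 'm, 'k) dgcat" where
  zero: "dg_module A M \<Longrightarrow> \<forall>x\<in>dgObj A. \<forall>m. mSp M x m = {0} \<Longrightarrow> perfect A M"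
| representable: "x \<in> dgObj A \<Longrightarrow> perfect A (yoneda A x)"
| shift: "perfect A M \<Longrightarrow> dg_shift (dg_Mod A) M N \<or> dg_shift (dg_Mod A) N M \<Longrightarrow> perfect A N"
| cone: "perfect A M \<Longrightarrow> perfect A N \<Longrightarrow> dg_cone (dg_Mod A) M N P f i p \<Longrightarrow> perfect A P"
| summand: "perfect A M \<Longrightarrow> dg_module A N \<Longrightarrow>
    i \<in> dgZ (dg_Mod A) N M 0 \<Longrightarrow> r \<in> dgZ (dg_Mod A) M N 0 \<Longrightarrow>
    homotopic (dg_Mod A) N N 0 (dgComp (dg_Mod A) N M N 0 0 r i) (dgId (dg_Mod A) N) \<Longrightarrow>
    perfect A N"

definition dg_Perf ::
  "('o, 'm::ab_group_add, 'k::field) dgcat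
    \<Rightarrow> (('o, 'm) dgmod, 'o \<Rightarrow> int \<Rightarrow> 'm \<Rightarrow> 'm, 'k) dgcat" where
  "dg_Perf A = dg_full (dg_Mod A) {M. perfect A M}"


section \<open>Graded categories with distinguished triangles\<close>

text \<open>
  A triangulated category is encoded by its graded category, whose morphisms \<open>x \<rightarrow> y\<close> of degree
  \<open>n\<close> are the morphisms \<open>x \<rightarrow> y[n]\<close>, together with its distinguished triangles
  \<open>x \<rightarrow> y \<rightarrow> z \<rightarrow> x[1]\<close>; the third map of a triangle is a morphism \<open>z \<rightarrow> x\<close> of degree 1. An exact
  functor (with its compatibility with shifts) is then a graded functor preserving triangles.
\<close>

record ('o, 'm, 'k) gcat =
  gObj :: "'o set"
  gHom :: "'o \<Rightarrow> 'o \<Rightarrow> int \<Rightarrow> 'm set"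
  gAdd :: "'o \<Rightarrow> 'o \<Rightarrow> int \<Rightarrow> 'm \<Rightarrow> 'm \<Rightarrow> 'm"
  gScl :: "'o \<Rightarrow> 'o \<Rightarrow> int \<Rightarrow> 'k \<Rightarrow> 'm \<Rightarrow> 'm"
  gComp :: "'o \<Rightarrow> 'o \<Rightarrow> 'o \<Rightarrow> int \<Rightarrow> int \<Rightarrow> 'm \<Rightarrow> 'm \<Rightarrow> 'm"
  gId :: "'o \<Rightarrow> 'm"
  gTri :: "'o \<Rightarrow> 'o \<Rightarrow> 'o \<Rightarrow> 'm \<Rightarrow> 'm \<Rightarrow> 'm \<Rightarrow> bool"

definition g_inverse :: "('o, 'm, 'k) gcat \<Rightarrow> 'o \<Rightarrow> 'o \<Rightarrow> int \<Rightarrow> 'm \<Rightarrow> 'm \<Rightarrow> bool" where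
  "g_inverse T x y n f g \<longleftrightarrow>
     x \<in> gObj T \<and> y \<in> gObj T \<and> f \<in> gHom T x y n \<and> g \<in> gHom T y x (- n) \<and>
     gComp T x y x n (- n) g f = gId T x \<and> gComp T y x y (- n) n f g = gId T y"

definition g_iso :: "('o, 'm, 'k) gcat \<Rightarrow> 'o \<Rightarrow> 'o \<Rightarrow> 'm \<Rightarrow> bool" where
  "g_iso T x y f \<longleftrightarrow> (\<exists>g. g_inverse T x y 0 f g)"

text \<open>\<open>y\<close> is isomorphic to \<open>x[1]\<close>.\<close>

definition g_shift :: "('o, 'm, 'k) gcat \<Rightarrow> 'o \<Rightarrow> 'o \<Rightarrow> bool" where
  "g_shift T x y \<longleftrightarrow> (\<exists>u v. g_inverse T x y (-1) u v)"

definition g_zero :: "('o, 'm, 'k) gcat \<Rightarrow> 'o \<Rightarrow> bool" where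
  "g_zero T z \<longleftrightarrow> z \<in> gObj T \<and> gHom T z z 0 = {gId T z}"

definition triangulated_sub :: "('o, 'm, 'k) gcat \<Rightarrow> 'o set \<Rightarrow> bool" where
  "triangulated_sub T S \<longleftrightarrow>
     S \<subseteq> gObj T \<and> (\<exists>z\<in>S. g_zero T z) \<and>
     (\<forall>x\<in>S. (\<exists>y\<in>S. g_shift T x y) \<and> (\<exists>y\<in>S. g_shift T y x)) \<and>
     (\<forall>x\<in>S. \<forall>y\<in>S. \<forall>z f g h. gTri T x y z f g h \<longrightarrow> (\<exists>z'\<in>S. \<exists>w. g_iso T z z' w))"

text \<open>Admissible: a full triangulated subcategory whose inclusion has a right and a left adjoint.\<close>

definition admissible :: "('o, 'm, 'k) gcat \<Rightarrow> 'o set \<Rightarrow> bool" where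
  "admissible T S \<longleftrightarrow>
     triangulated_sub T S \<and>
     (\<forall>t\<in>gObj T. \<exists>a\<in>S. \<exists>c\<in>gHom T a t 0. \<forall>s\<in>S.
        bij_betw (gComp T s a t 0 0 c) (gHom T s a 0) (gHom T s t 0)) \<and>
     (\<forall>t\<in>gObj T. \<exists>a\<in>S. \<exists>c\<in>gHom T t a 0. \<forall>s\<in>S.
        bij_betw (\<lambda>f. gComp T t a s 0 0 f c) (gHom T a s 0) (gHom T t s 0))"

text \<open>
  Semiorthogonal decomposition \<open>\<langle>A, B\<rangle>\<close>: no nonzero morphisms from \<open>B\<close> to \<open>A\<close>, and every object
  \<open>t\<close> sits in a distinguished triangle \<open>b \<rightarrow> t \<rightarrow> a \<rightarrow> b[1]\<close>.
\<close>

definition semiorthogonal :: "('o, 'm, 'k) gcat \<Rightarrow> 'o set \<Rightarrow> 'o set \<Rightarrow> bool" where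
  "semiorthogonal T A B \<longleftrightarrow>
     triangulated_sub T A \<and> triangulated_sub T B \<and>
     (\<forall>b\<in>B. \<forall>a\<in>A. \<exists>f. gHom T b a 0 = {f}) \<and>
     (\<forall>t\<in>gObj T. \<exists>b\<in>B. \<exists>a\<in>A. \<exists>f g h. gTri T b t a f g h)"

definition exact_equivalence ::
  "('o, 'm, 'k) gcat \<Rightarrow> ('p, 'n, 'k) gcat \<Rightarrow> ('o \<Rightarrow> 'p) \<Rightarrow> ('o \<Rightarrow> 'o \<Rightarrow> int \<Rightarrow> 'm \<Rightarrow> 'n) \<Rightarrow> bool" where
  "exact_equivalence T U F \<Phi> \<longleftrightarrow>
     (\<forall>x\<in>gObj T. F x \<in> gObj U \<and> \<Phi> x x 0 (gId T x) = gId U (F x)) \<and>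
     (\<forall>x\<in>gObj T. \<forall>y\<in>gObj T. \<forall>n.
        bij_betw (\<Phi> x y n) (gHom T x y n) (gHom U (F x) (F y) n) \<and>
        (\<forall>f\<in>gHom T x y n. \<forall>g\<in>gHom T x y n.
           \<Phi> x y n (gAdd T x y n f g) = gAdd U (F x) (F y) n (\<Phi> x y n f) (\<Phi> x y n g)) \<and>
        (\<forall>c. \<forall>f\<in>gHom T x y n. \<Phi> x y n (gScl T x y n c f) = gScl U (F x) (F y) n c (\<Phi> x y n f))) \<and>
     (\<forall>x\<in>gObj T. \<forall>y\<in>gObj T. \<forall>z\<in>gObj T. \<forall>m n. \<forall>f\<in>gHom T x y m. \<forall>g\<in>gHom T y z n.
        \<Phi> x z (m + n) (gComp T x y z m n g f) =
        gComp U (F x) (F y) (F z) m n (\<Phi> y z n g) (\<Phi> x y m f)) \<and>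
     (\<forall>y\<in>gObj U. \<exists>x\<in>gObj T. \<exists>w. g_iso U (F x) y w) \<and>
     (\<forall>x\<in>gObj T. \<forall>y\<in>gObj T. \<forall>z\<in>gObj T. \<forall>f g h. gTri T x y z f g h \<longrightarrow>
        gTri U (F x) (F y) (F z) (\<Phi> x y 0 f) (\<Phi> y z 0 g) (\<Phi> z x 1 h))"

text \<open>
  The graded homotopy category of a dg category, with the morphisms of degree 0 forming \<open>H\<^sup>0\<close>.
  A triangle is distinguished if the Yoneda embedding takes it to a triangle isomorphic, in the
  homotopy category of dg modules, to a cone triangle.
\<close>

definition hclass :: "('o, 'm::ab_group_add, 'k) dgcat \<Rightarrow> 'o \<Rightarrow> 'o \<Rightarrow> int \<Rightarrow> 'm \<Rightarrow> 'm set" where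
  "hclass A x y n f = {g \<in> dgZ A x y n. homotopic A x y n g f}"

definition homotopy_cat :: "('o, 'm::ab_group_add, 'k::field) dgcat \<Rightarrow> ('o, 'm set, 'k) gcat" where
  "homotopy_cat A =
     \<lparr>gObj = dgObj A,
      gHom = (\<lambda>x y n. hclass A x y n ` dgZ A x y n),
      gAdd = (\<lambda>x y n F G. \<Union>f\<in>F. \<Union>g\<in>G. hclass A x y n (f + g)),
      gScl = (\<lambda>x y n c F. \<Union>f\<in>F. hclass A x y n (dgScl A c f)),
      gComp = (\<lambda>x y z m n G F. \<Union>f\<in>F. \<Union>g\<in>G. hclass A x z (m + n) (dgComp A x y z m n g f)),
      gId = (\<lambda>x. hclass A x x 0 (dgId A x)),
      gTri = (\<lambda>x y z F G H. x \<in> dgObj A \<and> y \<in> dgObj A \<and> z \<in> dgObj A \<and>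
        (\<exists>f\<in>dgZ A x y 0. \<exists>g\<in>dgZ A y z 0. \<exists>h\<in>dgZ A z x 1.
           F = hclass A x y 0 f \<and> G = hclass A y z 0 g \<and> H = hclass A z x 1 h \<and>
           (\<exists>C i p w.
              dg_cone (dg_Mod A) (yoneda A x) (yoneda A y) C (yoneda_map A x y 0 f) i p \<and>
              homotopy_equivalence (dg_Mod A) (yoneda A z) C w \<and>
              homotopic (dg_Mod A) (yoneda A y) C 0
                (dgComp (dg_Mod A) (yoneda A y) (yoneda A z) C 0 0 w (yoneda_map A y z 0 g)) i \<and>
              homotopic (dg_Mod A) (yoneda A z) (yoneda A x) 1
                (dgComp (dg_Mod A) (yoneda A z) C (yoneda A x) 0 1 p w) (yoneda_map A z x 1 h))))\<rparr>"

text \<open>Pretriangulated: shifts and cones of representable modules are representable up to homotopy.\<close>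

definition pretriangulated :: "('o, 'm::ab_group_add, 'k::field) dgcat \<Rightarrow> bool" where
  "pretriangulated A \<longleftrightarrow>
     (\<exists>z. g_zero (homotopy_cat A) z) \<and>
     (\<forall>x\<in>dgObj A. (\<exists>y. g_shift (homotopy_cat A) x y) \<and> (\<exists>y. g_shift (homotopy_cat A) y x)) \<and>
     (\<forall>x\<in>dgObj A. \<forall>y\<in>dgObj A. \<forall>f\<in>gHom (homotopy_cat A) x y 0.
        \<exists>z g h. gTri (homotopy_cat A) x y z f g h)"


section \<open>Smooth projective varieties\<close>

text \<open>
  A projective variety in projective space with homogeneous coordinates \<open>x\<^sub>0, \<dots>, x\<^sub>N\<close> is given by
  the pair of \<open>N\<close> and its homogeneous prime ideal \<open>I\<close>; it is the scheme Proj of \<open>k[x\<^sub>0, \<dots>, x\<^sub>N]/I\<close>.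
\<close>

type_synonym 'k mpoly = "(nat \<Rightarrow>\<^sub>0 nat) \<Rightarrow>\<^sub>0 'k"
type_synonym 'k variety = "nat \<times> 'k mpoly set"
type_synonym 'k point = "'k mpoly set"

definition poly_ring :: "nat \<Rightarrow> 'k::field mpoly ring" where
  "poly_ring N =
     \<lparr>carrier = {f. \<forall>m\<in>Poly_Mapping.keys f. Poly_Mapping.keys m \<subseteq> {..N}},
      mult = (*), one = 1, zero = 0, add = (+)\<rparr>"

definition mvar :: "nat \<Rightarrow> 'k::field mpoly" where
  "mvar i = Poly_Mapping.single (Poly_Mapping.single i 1) 1"

definition mconst :: "'k::field \<Rightarrow> 'k mpoly" where
  "mconst c = Poly_Mapping.single 0 c"

definition homogeneous :: "nat \<Rightarrow> 'k::field mpoly \<Rightarrow> bool" where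
  "homogeneous d f \<longleftrightarrow>
     (\<forall>m\<in>Poly_Mapping.keys f. (\<Sum>i\<in>Poly_Mapping.keys m. Poly_Mapping.lookup m i) = d)"

definition mderiv :: "nat \<Rightarrow> 'k::field mpoly \<Rightarrow> 'k mpoly" where
  "mderiv i f = (\<Sum>m\<in>Poly_Mapping.keys f.
     Poly_Mapping.single (m - Poly_Mapping.single i 1)
       (of_nat (Poly_Mapping.lookup m i) * Poly_Mapping.lookup f m))"

definition homogeneous_prime :: "nat \<Rightarrow> 'k::field mpoly set \<Rightarrow> bool" where
  "homogeneous_prime N P \<longleftrightarrow>
     primeideal P (poly_ring N) \<and> P = Idl\<^bsub>poly_ring N\<^esub> {f \<in> P. \<exists>d. homogeneous d f}"

definition projective_variety :: "'k::field variety \<Rightarrow> bool" where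
  "projective_variety = (\<lambda>(N, I). homogeneous_prime N I \<and> (\<exists>i\<le>N. mvar i \<notin> I))"

definition points :: "'k::field variety \<Rightarrow> 'k point set" where
  "points = (\<lambda>(N, I). {P. homogeneous_prime N P \<and> I \<subseteq> P \<and> (\<exists>i\<le>N. mvar i \<notin> P)})"

definition opens :: "'k::field variety \<Rightarrow> 'k point set set" where
  "opens X = {U. \<exists>E. (\<forall>f\<in>E. f \<in> carrier (poly_ring (fst X)) \<and> (\<exists>d. homogeneous d f)) \<and>
                     U = {P \<in> points X. \<not> E \<subseteq> P}}"

text \<open>
  Jacobian criterion (standard smoothness) in the affine chart \<open>x\<^sub>i \<noteq> 0\<close>: near \<open>P\<close> the ideal is
  generated by \<open>c\<close> equations having a \<open>c \<times> c\<close> Jacobian minor, with respect to the coordinates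
  other than \<open>x\<^sub>i\<close>, that does not vanish at \<open>P\<close>. Up to powers of \<open>x\<^sub>i\<close>, derivatives of
  homogeneous equations with respect to these coordinates are those of the dehomogenized ones.
\<close>

definition smooth_at :: "'k::field variety \<Rightarrow> 'k point \<Rightarrow> bool" where
  "smooth_at = (\<lambda>(N, I) P.
     \<exists>i\<le>N. mvar i \<notin> P \<and>
       (\<exists>(c::nat) f j.
          (\<forall>a<c. f a \<in> I \<and> (\<exists>d. homogeneous d (f a))) \<and>
          inj_on j {..<c} \<and> j ` {..<c} \<subseteq> {..N} - {i} \<and>
          (\<Sum>\<pi>\<in>{\<pi>. \<pi> permutes {..<c}}. of_int (sign \<pi>) * (\<Prod>a<c. mderiv (j (\<pi> a)) (f a))) \<notin> P \<and>
          (\<forall>h\<in>I. \<exists>s\<in>carrier (poly_ring N) - P. s * h \<in> Idl\<^bsub>poly_ring N\<^esub> (f ` {..<c}))))"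

definition smooth_projective :: "'k::field variety \<Rightarrow> bool" where
  "smooth_projective X \<longleftrightarrow> projective_variety X \<and> (\<forall>P\<in>points X. smooth_at X P)"

text \<open>
  The function field: fractions \<open>f/g\<close> of homogeneous polynomials of equal degree with \<open>g \<notin> I\<close>.
  As the variety is integral, the sections of the structure sheaf over a nonempty open set \<open>U\<close>
  are the elements of the function field that are regular at all points of \<open>U\<close>.
\<close>

definition frac_pairs :: "'k::field variety \<Rightarrow> ('k mpoly \<times> 'k mpoly) set" where
  "frac_pairs = (\<lambda>(N, I). {(f, g). f \<in> carrier (poly_ring N) \<and> g \<in> carrier (poly_ring N) \<and> g \<notin> I \<and>
     (\<exists>d. homogeneous d f \<and> homogeneous d g)})"

definition frac :: "'k::field variety \<Rightarrow> 'k mpoly \<times> 'k mpoly \<Rightarrow> ('k mpoly \<times> 'k mpoly) set" where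
  "frac X = (\<lambda>(f, g). {(f', g') \<in> frac_pairs X. f * g' - f' * g \<in> snd X})"

definition function_field :: "'k::field variety \<Rightarrow> ('k mpoly \<times> 'k mpoly) set ring" where
  "function_field X =
     \<lparr>carrier = frac X ` frac_pairs X,
      mult = (\<lambda>a b. \<Union>(f, g)\<in>a. \<Union>(f', g')\<in>b. frac X (f * f', g * g')),
      one = frac X (1, 1), zero = frac X (0, 1),
      add = (\<lambda>a b. \<Union>(f, g)\<in>a. \<Union>(f', g')\<in>b. frac X (f * g' + f' * g, g * g'))\<rparr>"

type_synonym 'k rat_fun = "('k mpoly \<times> 'k mpoly) set"

definition regular_on :: "'k::field variety \<Rightarrow> 'k point set \<Rightarrow> 'k rat_fun set" where
  "regular_on X U = {a \<in> carrier (function_field X).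
     \<forall>P\<in>U. \<exists>(f, g)\<in>frac_pairs X. g \<notin> P \<and> a = frac X (f, g)}"


section \<open>The bounded derived category of coherent sheaves\<close>

text \<open>
  The universe of vectors. Every vector space of dimension at most \<open>|k|\<close> to the power \<open>\<aleph>\<^sub>0\<close> is isomorphic
  to a subspace of \<open>nat \<Rightarrow> 'k\<close>; this bounds all spaces of sections and all Hom-spaces that are needed.
\<close>

type_synonym 'k vec = "nat \<Rightarrow> 'k"

definition vscale :: "'k::field \<Rightarrow> ('i \<Rightarrow> 'k) \<Rightarrow> 'i \<Rightarrow> 'k" where
  "vscale c v = (\<lambda>i. c * v i)"

record (overloaded) ('k::field) sheaf =
  Sec :: "'k point set \<Rightarrow> 'k vec set"
  Act :: "'k point set \<Rightarrow> 'k rat_fun \<Rightarrow> 'k vec \<Rightarrow> 'k vec"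
  Res :: "'k point set \<Rightarrow> 'k point set \<Rightarrow> 'k vec \<Rightarrow> 'k vec"

text \<open>
  Sheaves of \<open>\<O>\<^sub>X\<close>-modules. The empty cover forces the sections over the empty set to vanish, so the
  convention used for \<open>regular_on X {}\<close> is harmless.
\<close>

definition module_sheaf :: "'k::field variety \<Rightarrow> 'k sheaf \<Rightarrow> bool" where
  "module_sheaf X F \<longleftrightarrow>
     (\<forall>U\<in>opens X.
        module.subspace vscale (Sec F U) \<and>
        (\<forall>a\<in>regular_on X U. linear_between vscale (Sec F U) vscale (Sec F U) (Act F U a)) \<and>
        (\<forall>a\<in>regular_on X U. \<forall>b\<in>regular_on X U. \<forall>s\<in>Sec F U.
           Act F U (a \<oplus>\<^bsub>function_field X\<^esub> b) s = Act F U a s + Act F U b s \<and>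
           Act F U (a \<otimes>\<^bsub>function_field X\<^esub> b) s = Act F U a (Act F U b s)) \<and>
        (\<forall>c. \<forall>s\<in>Sec F U. Act F U (frac X (mconst c, 1)) s = vscale c s)) \<and>
     (\<forall>U\<in>opens X. \<forall>V\<in>opens X. V \<subseteq> U \<longrightarrow>
        linear_between vscale (Sec F U) vscale (Sec F V) (Res F U V) \<and>
        (\<forall>a\<in>regular_on X U. \<forall>s\<in>Sec F U. Res F U V (Act F U a s) = Act F V a (Res F U V s))) \<and>
     (\<forall>U\<in>opens X. \<forall>s\<in>Sec F U. Res F U U s = s) \<and>
     (\<forall>U\<in>opens X. \<forall>V\<in>opens X. \<forall>W\<in>opens X. W \<subseteq> V \<and> V \<subseteq> U \<longrightarrow>
        (\<forall>s\<in>Sec F U. Res F V W (Res F U V s) = Res F U W s)) \<and>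
     (\<forall>\<U>. \<U> \<subseteq> opens X \<longrightarrow>
        (\<forall>s. (\<forall>U\<in>\<U>. s U \<in> Sec F U) \<and>
             (\<forall>U\<in>\<U>. \<forall>V\<in>\<U>. Res F U (U \<inter> V) (s U) = Res F V (U \<inter> V) (s V)) \<longrightarrow>
             (\<exists>!t. t \<in> Sec F (\<Union>\<U>) \<and> (\<forall>U\<in>\<U>. Res F (\<Union>\<U>) U t = s U))))"

definition finite_type :: "'k::field variety \<Rightarrow> 'k sheaf \<Rightarrow> bool" where
  "finite_type X F \<longleftrightarrow>
     (\<forall>P\<in>points X. \<exists>U\<in>opens X. P \<in> U \<and> (\<exists>(n::nat) s. (\<forall>i<n. s i \<in> Sec F U) \<and>
        (\<forall>Q\<in>U. \<forall>V\<in>opens X. Q \<in> V \<and> V \<subseteq> U \<longrightarrow> (\<forall>t\<in>Sec F V.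
           \<exists>W\<in>opens X. Q \<in> W \<and> W \<subseteq> V \<and> (\<exists>c. (\<forall>i<n. c i \<in> regular_on X W) \<and>
             Res F V W t = (\<Sum>i<n. Act F W (c i) (Res F U W (s i))))))))"

text \<open>
  Coherent: of finite type, and for all sections \<open>s\<^sub>0, \<dots>, s\<^sub>n\<^sub>-\<^sub>1\<close> over an open set the kernel of the
  induced map from \<open>\<O>\<^sub>X\<^sup>n\<close> (the sheaf of relations) is of finite type.
\<close>

definition relations ::
  "'k::field variety \<Rightarrow> 'k sheaf \<Rightarrow> 'k point set \<Rightarrow> nat \<Rightarrow> (nat \<Rightarrow> 'k vec) \<Rightarrow> 'k point set
    \<Rightarrow> (nat \<Rightarrow> 'k rat_fun) set" where
  "relations X F U n s V = {r. (\<forall>i<n. r i \<in> regular_on X V) \<and>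
     (\<Sum>i<n. Act F V (r i) (Res F U V (s i))) = 0}"

definition coherent :: "'k::field variety \<Rightarrow> 'k sheaf \<Rightarrow> bool" where
  "coherent X F \<longleftrightarrow>
     module_sheaf X F \<and> finite_type X F \<and>
     (\<forall>U\<in>opens X. \<forall>(n::nat) s. (\<forall>i<n. s i \<in> Sec F U) \<longrightarrow>
        (\<forall>P\<in>U. \<exists>V\<in>opens X. P \<in> V \<and> V \<subseteq> U \<and>
           (\<exists>(m::nat) R. (\<forall>j<m. R j \<in> relations X F U n s V) \<and>
              (\<forall>Q\<in>V. \<forall>W\<in>opens X. Q \<in> W \<and> W \<subseteq> V \<longrightarrow> (\<forall>r\<in>relations X F U n s W.
                 \<exists>W'\<in>opens X. Q \<in> W' \<and> W' \<subseteq> W \<and> (\<exists>c. (\<forall>j<m. c j \<in> regular_on X W') \<and>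
                   (\<forall>i<n. r i = (\<Oplus>\<^bsub>function_field X\<^esub>j\<in>{..<m}. c j \<otimes>\<^bsub>function_field X\<^esub> R j i))))))))"

definition sheaf_hom ::
  "'k::field variety \<Rightarrow> 'k sheaf \<Rightarrow> 'k sheaf \<Rightarrow> ('k point set \<Rightarrow> 'k vec \<Rightarrow> 'k vec) \<Rightarrow> bool" where
  "sheaf_hom X F G \<phi> \<longleftrightarrow>
     (\<forall>U\<in>opens X. linear_between vscale (Sec F U) vscale (Sec G U) (\<phi> U) \<and>
        (\<forall>a\<in>regular_on X U. \<forall>s\<in>Sec F U. \<phi> U (Act F U a s) = Act G U a (\<phi> U s)) \<and>
        (\<forall>V\<in>opens X. V \<subseteq> U \<longrightarrow> (\<forall>s\<in>Sec F U. \<phi> V (Res F U V s) = Res G U V (\<phi> U s)))) \<and>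
     (\<forall>U s. U \<notin> opens X \<or> s \<notin> Sec F U \<longrightarrow> \<phi> U s = 0)"

record (overloaded) ('k::field) complex_of_sheaves =
  Term :: "int \<Rightarrow> 'k sheaf"
  Dif :: "int \<Rightarrow> 'k point set \<Rightarrow> 'k vec \<Rightarrow> 'k vec"

definition bounded_coherent_complex :: "'k::field variety \<Rightarrow> 'k complex_of_sheaves \<Rightarrow> bool" where
  "bounded_coherent_complex X E \<longleftrightarrow>
     (\<forall>i. coherent X (Term E i) \<and> sheaf_hom X (Term E i) (Term E (i + 1)) (Dif E i) \<and>
        (\<forall>U\<in>opens X. \<forall>s\<in>Sec (Term E i) U. Dif E (i + 1) U (Dif E i U s) = 0)) \<and>
     (\<exists>b. \<forall>i. \<bar>i\<bar> > b \<longrightarrow> (\<forall>U\<in>opens X. Sec (Term E i) U = {0}))"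

definition coh_complexes ::
  "'k::field variety \<Rightarrow>
    ('k complex_of_sheaves, int \<Rightarrow> 'k point set \<Rightarrow> 'k vec \<Rightarrow> 'k vec, 'k) dgcat" where
  "coh_complexes X =
     \<lparr>dgObj = {E. bounded_coherent_complex X E},
      dgHom = (\<lambda>E F n. {\<phi>. \<forall>i. sheaf_hom X (Term E i) (Term F (i + n)) (\<phi> i)}),
      dgScl = (\<lambda>c \<phi> i U s. vscale c (\<phi> i U s)),
      dgDif = (\<lambda>E F n \<phi> i U s. Dif F (i + n) U (\<phi> i U s) - sg n (\<phi> (i + 1) U (Dif E i U s))),
      dgComp = (\<lambda>E F G m n \<psi> \<phi> i U s. \<psi> (i + m) U (\<phi> i U s)),
      dgId = (\<lambda>E i U s. if U \<in> opens X \<and> s \<in> Sec (Term E i) U then s else 0)\<rparr>"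

text \<open>
  Quasi-isomorphisms: chain maps inducing bijections on the stalks of all cohomology sheaves,
  spelled out in terms of local sections.
\<close>

definition quasi_isomorphism ::
  "'k::field variety \<Rightarrow> 'k complex_of_sheaves \<Rightarrow> 'k complex_of_sheaves
    \<Rightarrow> (int \<Rightarrow> 'k point set \<Rightarrow> 'k vec \<Rightarrow> 'k vec) \<Rightarrow> bool" where
  "quasi_isomorphism X E F \<phi> \<longleftrightarrow>
     \<phi> \<in> dgZ (coh_complexes X) E F 0 \<and>
     (\<forall>i. \<forall>U\<in>opens X. \<forall>P\<in>U.
        (\<forall>s\<in>Sec (Term E i) U.
           Dif E i U s = 0 \<and> (\<exists>t\<in>Sec (Term F (i - 1)) U. Dif F (i - 1) U t = \<phi> i U s) \<longrightarrow>
           (\<exists>V\<in>opens X. P \<in> V \<and> V \<subseteq> U \<and>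
              (\<exists>r\<in>Sec (Term E (i - 1)) V. Dif E (i - 1) V r = Res (Term E i) U V s))) \<and>
        (\<forall>t\<in>Sec (Term F i) U. Dif F i U t = 0 \<longrightarrow>
           (\<exists>V\<in>opens X. P \<in> V \<and> V \<subseteq> U \<and>
              (\<exists>s\<in>Sec (Term E i) V. Dif E i V s = 0 \<and>
                 (\<exists>r\<in>Sec (Term F (i - 1)) V.
                    Res (Term F i) U V t = \<phi> i V s + Dif F (i - 1) V r)))))"

text \<open>
  The derived category is the localization of the homotopy category of complexes at the
  quasi-isomorphisms. A roof \<open>(E', s, f)\<close> from \<open>E\<close> to \<open>F\<close> of degree \<open>n\<close> consists of a
  quasi-isomorphism \<open>s : E' \<rightarrow> E\<close> and a closed morphism \<open>f : E' \<rightarrow> F\<close> of degree \<open>n\<close>.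
\<close>

type_synonym 'k roof =
  "'k complex_of_sheaves \<times> (int \<Rightarrow> 'k point set \<Rightarrow> 'k vec \<Rightarrow> 'k vec)
    \<times> (int \<Rightarrow> 'k point set \<Rightarrow> 'k vec \<Rightarrow> 'k vec)"

definition roofs ::
  "'k::field variety \<Rightarrow> 'k complex_of_sheaves \<Rightarrow> 'k complex_of_sheaves \<Rightarrow> int \<Rightarrow> 'k roof set" where
  "roofs X E F n = {(E', s, f). E' \<in> dgObj (coh_complexes X) \<and> quasi_isomorphism X E' E s \<and>
     f \<in> dgZ (coh_complexes X) E' F n}"

definition roof_class ::
  "'k::field variety \<Rightarrow> 'k complex_of_sheaves \<Rightarrow> 'k complex_of_sheaves \<Rightarrow> int
    \<Rightarrow> 'k roof \<Rightarrow> 'k roof set" where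
  "roof_class X E F n = (\<lambda>(E1, s1, f1). {(E2, s2, f2) \<in> roofs X E F n.
     \<exists>E3\<in>dgObj (coh_complexes X).
       \<exists>u1\<in>dgZ (coh_complexes X) E3 E1 0. \<exists>u2\<in>dgZ (coh_complexes X) E3 E2 0.
         quasi_isomorphism X E3 E (dgComp (coh_complexes X) E3 E1 E 0 0 s1 u1) \<and>
         homotopic (coh_complexes X) E3 E 0
           (dgComp (coh_complexes X) E3 E1 E 0 0 s1 u1) (dgComp (coh_complexes X) E3 E2 E 0 0 s2 u2) \<and>
         homotopic (coh_complexes X) E3 F n
           (dgComp (coh_complexes X) E3 E1 F 0 n f1 u1) (dgComp (coh_complexes X) E3 E2 F 0 n f2 u2)})"

definition roof_of_map ::
  "'k::field variety \<Rightarrow> 'k complex_of_sheaves \<Rightarrow> 'k complex_of_sheaves \<Rightarrow> int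
    \<Rightarrow> (int \<Rightarrow> 'k point set \<Rightarrow> 'k vec \<Rightarrow> 'k vec) \<Rightarrow> 'k roof set" where
  "roof_of_map X E F n f = roof_class X E F n (E, dgId (coh_complexes X) E, f)"

text \<open>
  Sums are formed over a common denominator, composites by completing to a commutative (up to
  homotopy) square with a quasi-isomorphism \<open>u\<close>. The triangles of \<open>coh_derived_pre\<close> are a dummy;
  \<open>coh_derived\<close> supplies the triangles isomorphic to cone triangles of complexes.
\<close>

definition coh_derived_pre ::
  "'k::field variety \<Rightarrow> ('k complex_of_sheaves, 'k roof set, 'k) gcat" where
  "coh_derived_pre X =
     \<lparr>gObj = dgObj (coh_complexes X),
      gHom = (\<lambda>E F n. roof_class X E F n ` roofs X E F n),
      gAdd = (\<lambda>E F n a b. \<Union>{roof_class X E F n (E', s, f + g) | E' s f g.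
        (E', s, f) \<in> a \<and> (E', s, g) \<in> b}),
      gScl = (\<lambda>E F n c a. \<Union>{roof_class X E F n (E', s, dgScl (coh_complexes X) c f) | E' s f.
        (E', s, f) \<in> a}),
      gComp = (\<lambda>E F G m n b a.
        \<Union>{roof_class X E G (m + n)
             (E'', dgComp (coh_complexes X) E'' E' E 0 0 s u, dgComp (coh_complexes X) E'' F' G m n g h)
          | E' s f F' t g E'' u h.
            (E', s, f) \<in> a \<and> (F', t, g) \<in> b \<and> E'' \<in> dgObj (coh_complexes X) \<and>
            quasi_isomorphism X E'' E' u \<and> h \<in> dgZ (coh_complexes X) E'' F' m \<and>
            homotopic (coh_complexes X) E'' F m
              (dgComp (coh_complexes X) E'' F' F m 0 t h) (dgComp (coh_complexes X) E'' E' F 0 m f u)}),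
      gId = (\<lambda>E. roof_of_map X E E 0 (dgId (coh_complexes X) E)),
      gTri = (\<lambda>_ _ _ _ _ _. False)\<rparr>"

definition coh_derived ::
  "'k::field variety \<Rightarrow> ('k complex_of_sheaves, 'k roof set, 'k) gcat" where
  "coh_derived X = (let D = coh_derived_pre X in
     D\<lparr>gTri := (\<lambda>E F G \<alpha> \<beta> \<gamma>.
       \<alpha> \<in> gHom D E F 0 \<and> \<beta> \<in> gHom D F G 0 \<and> \<gamma> \<in> gHom D G E 1 \<and>
       (\<exists>E' F' G' f i p a b c.
          dg_cone (coh_complexes X) E' F' G' f i p \<and>
          g_iso D E E' a \<and> g_iso D F F' b \<and> g_iso D G G' c \<and>
          gComp D E F F' 0 0 b \<alpha> = gComp D E E' F' 0 0 (roof_of_map X E' F' 0 f) a \<and>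
          gComp D F G G' 0 0 c \<beta> = gComp D F F' G' 0 0 (roof_of_map X F' G' 0 i) b \<and>
          gComp D G E E' 1 0 a \<gamma> = gComp D G G' E' 0 1 (roof_of_map X G' E' 1 p) c))\<rparr>)"


section \<open>Geometric dg categories\<close>

text \<open>
  The universe of dg categories: objects and Hom-spaces are taken from \<open>nat \<Rightarrow> 'k\<close>, which is large
  enough to contain a representative of every quasi-equivalence class of geometric dg categories.
\<close>

type_synonym 'k dgc = "('k vec, 'k vec, 'k) dgcat"

definition small_dg :: "'k::field dgc \<Rightarrow> bool" where
  "small_dg V \<longleftrightarrow> dg_category V \<and> dgScl V = vscale"

definition semiorthogonal_summand :: "('o, 'm, 'k) gcat \<Rightarrow> 'o set \<Rightarrow> bool" where
  "semiorthogonal_summand T S \<longleftrightarrow> (\<exists>S'. semiorthogonal T S S' \<or> semiorthogonal T S' S)"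

definition geometric :: "'k::field dgc \<Rightarrow> bool" where
  "geometric V \<longleftrightarrow>
     small_dg V \<and> pretriangulated V \<and>
     (\<exists>X S F \<Phi>. smooth_projective X \<and> semiorthogonal_summand (coh_derived X) S \<and>
        exact_equivalence (homotopy_cat V) ((coh_derived X)\<lparr>gObj := S\<rparr>) F \<Phi>)"

text \<open>
  Quasi-equivalence of dg categories in the universe is the equivalence relation generated by
  quasi-equivalences. The quasi-equivalence class of a dg category \<open>X\<close> that need not live in
  the universe consists of the dg categories in the universe that are quasi-equivalent to it.
\<close>

definition quasi_equivalent :: "'k::field dgc \<Rightarrow> 'k dgc \<Rightarrow> bool" where
  "quasi_equivalent = (\<lambda>V W. small_dg V \<and> small_dg W \<and>
     (\<exists>F \<Phi>. quasi_equivalence V W F \<Phi> \<or> quasi_equivalence W V F \<Phi>))\<^sup>*\<^sup>*"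

definition qclass :: "('o, 'm::ab_group_add, 'k::field) dgcat \<Rightarrow> 'k dgc set" where
  "qclass X = {V. small_dg V \<and>
     (\<exists>W F \<Phi>. quasi_equivalent V W \<and> quasi_equivalence W X F \<Phi>)}"


section \<open>Tensor products and symmetric powers\<close>

text \<open>
  The tensor product of a list of dg categories. A multihomogeneous pure tensor
  \<open>f\<^sub>0 \<otimes> \<dots> \<otimes> f\<^sub>n\<^sub>-\<^sub>1\<close> with degrees \<open>ds\<close> is encoded as the function sending \<open>(ds, is)\<close> to
  the product of the coordinates \<open>f\<^sub>j (is\<^sub>j)\<close> and vanishing on all other degree lists; over a field
  the span of these functions is the tensor product. A triple \<open>(c, ds, fs)\<close> represents \<open>c\<close> times
  a pure tensor. For the empty list this yields the unit, i.e. \<open>k\<close> with a single object.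
\<close>

type_synonym 'k tensor = "int list \<times> nat list \<Rightarrow> 'k"
type_synonym 'k tterm = "'k \<times> int list \<times> 'k vec list"

definition pure_tensor :: "'k::field tterm \<Rightarrow> 'k tensor" where
  "pure_tensor = (\<lambda>(c, ds, fs) (es, is).
     if es = ds \<and> length is = length fs then c * (\<Prod>j<length fs. (fs ! j) (is ! j)) else 0)"

definition tensor_sum :: "'k::field tterm list \<Rightarrow> 'k tensor" where
  "tensor_sum ts = (\<Sum>t\<leftarrow>ts. pure_tensor t)"

definition tensor_terms ::
  "'k::field dgc list \<Rightarrow> 'k vec list \<Rightarrow> 'k vec list \<Rightarrow> int \<Rightarrow> 'k tterm set" where
  "tensor_terms As xs ys n = {(c, ds, fs).
     length ds = length As \<and> length fs = length As \<and> sum_list ds = n \<and>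
     (\<forall>j<length As. fs ! j \<in> dgHom (As ! j) (xs ! j) (ys ! j) (ds ! j))}"

text \<open>
  Koszul signs: \<open>(g\<^sub>0 \<otimes> \<dots>) \<circ> (f\<^sub>0 \<otimes> \<dots>)\<close> is \<open>(-1)\<close> to the sum of \<open>|g\<^sub>i| |f\<^sub>j|\<close> over \<open>j < i\<close> times
  \<open>(g\<^sub>0 \<circ> f\<^sub>0) \<otimes> \<dots>\<close>, and differentiating the factor \<open>j\<close> costs \<open>(-1)\<close> to the sum of \<open>|f\<^sub>i|\<close> over \<open>i < j\<close>.
\<close>

definition term_comp ::
  "'k::field dgc list \<Rightarrow> 'k vec list \<Rightarrow> 'k vec list \<Rightarrow> 'k vec list \<Rightarrow> 'k tterm \<Rightarrow> 'k tterm \<Rightarrow> 'k tterm" where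
  "term_comp As xs ys zs = (\<lambda>(c, es, gs) (b, ds, fs).
     (sg (\<Sum>i<length As. \<Sum>j<i. es ! i * ds ! j) (c * b),
      map2 (+) ds es,
      map (\<lambda>i. dgComp (As ! i) (xs ! i) (ys ! i) (zs ! i) (ds ! i) (es ! i) (gs ! i) (fs ! i))
        [0..<length As]))"

definition term_dif ::
  "'k::field dgc list \<Rightarrow> 'k vec list \<Rightarrow> 'k vec list \<Rightarrow> nat \<Rightarrow> 'k tterm \<Rightarrow> 'k tterm" where
  "term_dif As xs ys j = (\<lambda>(c, ds, fs).
     (sg (\<Sum>i<j. ds ! i) c,
      ds[j := ds ! j + 1],
      fs[j := dgDif (As ! j) (xs ! j) (ys ! j) (ds ! j) (fs ! j)]))"

definition dg_tensor :: "'k::field dgc list \<Rightarrow> ('k vec list, 'k tensor, 'k) dgcat" where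
  "dg_tensor As =
     \<lparr>dgObj = {xs. list_all2 (\<lambda>A x. x \<in> dgObj A) As xs},
      dgHom = (\<lambda>xs ys n. tensor_sum ` {ts. set ts \<subseteq> tensor_terms As xs ys n}),
      dgScl = vscale,
      dgDif = (\<lambda>xs ys n F. THE G. \<exists>ts. set ts \<subseteq> tensor_terms As xs ys n \<and> F = tensor_sum ts \<and>
        G = tensor_sum [term_dif As xs ys j t. t \<leftarrow> ts, j \<leftarrow> [0..<length As]]),
      dgComp = (\<lambda>xs ys zs m n G F. THE H. \<exists>gs fs.
        set gs \<subseteq> tensor_terms As ys zs n \<and> set fs \<subseteq> tensor_terms As xs ys m \<and>
        G = tensor_sum gs \<and> F = tensor_sum fs \<and>
        H = tensor_sum [term_comp As xs ys zs g f. g \<leftarrow> gs, f \<leftarrow> fs]),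
      dgId = (\<lambda>xs. pure_tensor (1, replicate (length As) 0, map2 dgId As xs))\<rparr>"

text \<open>
  The completed tensor power is formed in one step from \<open>V \<otimes> \<dots> \<otimes> V\<close>, rather than by iterating
  \<open>dg_box\<close> (to which it is quasi-equivalent), so that permutations act strictly.
\<close>

definition dg_box where
  "dg_box (V :: 'k::field dgc) W = dg_Perf (dg_tensor [V, W])"

definition dg_power where
  "dg_power n (V :: 'k::field dgc) = dg_Perf (dg_tensor (replicate n V))"

text \<open>
  A permutation \<open>g\<close> of the tensor factors moves factor \<open>j\<close> to position \<open>g j\<close>, with the Koszul sign
  determined by the degrees \<open>ds\<close> of the factors before the permutation.
\<close>

definition perm_obj :: "(nat \<Rightarrow> nat) \<Rightarrow> 'a list \<Rightarrow> 'a list" where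
  "perm_obj g xs = permute_list (inv_into UNIV g) xs"

definition perm_tensor :: "(nat \<Rightarrow> nat) \<Rightarrow> 'k::field tensor \<Rightarrow> 'k tensor" where
  "perm_tensor g T = (\<lambda>(es, is). let ds = permute_list g es in
     sg (\<Sum>(i, j)\<in>{(i, j). i < j \<and> j < length ds \<and> g j < g i}. ds ! i * ds ! j)
       (T (ds, permute_list g is)))"

text \<open>
  The action \<open>\<rho>\<close> of permutations on modules over a tensor power is by pullback along the inverse
  permutation, so that \<open>\<rho> (g \<circ> h) = \<rho> g \<circ> \<rho> h\<close>.
\<close>

definition rho :: "(nat \<Rightarrow> nat) \<Rightarrow> ('k vec list, 'k::field tensor) dgmod \<Rightarrow> ('k vec list, 'k tensor) dgmod" where
  "rho g M =
     \<lparr>mSp = (\<lambda>xs. mSp M (perm_obj (inv_into UNIV g) xs)),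
      mDif = (\<lambda>xs. mDif M (perm_obj (inv_into UNIV g) xs)),
      mAct = (\<lambda>xs ys m n a u.
        mAct M (perm_obj (inv_into UNIV g) xs) (perm_obj (inv_into UNIV g) ys) m n a (perm_tensor (inv_into UNIV g) u))\<rparr>"

definition rho_map :: "(nat \<Rightarrow> nat) \<Rightarrow> ('k vec list \<Rightarrow> 'b) \<Rightarrow> 'k vec list \<Rightarrow> 'b" where
  "rho_map g \<phi> = (\<lambda>xs. \<phi> (perm_obj (inv_into UNIV g) xs))"

text \<open>
  The symmetric power: equivariant objects \<open>(M, \<epsilon>)\<close>, where \<open>\<epsilon> g : M \<rightarrow> \<rho> g M\<close>, in the tensor power.
\<close>

definition dg_Sym where
  "dg_Sym n (V :: 'k::field dgc) = (let P = dg_power n V; G = {g. g permutes {..<n}} in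
     \<lparr>dgObj = {(M, \<epsilon>). M \<in> dgObj P \<and>
        (\<forall>g\<in>G. strict_iso P M (rho g M) (\<epsilon> g)) \<and>
        (\<forall>g\<in>G. \<forall>h\<in>G. \<epsilon> (g \<circ> h) =
           dgComp P M (rho g M) (rho g (rho h M)) 0 0 (rho_map g (\<epsilon> h)) (\<epsilon> g))},
      dgHom = (\<lambda>(M, \<epsilon>) (N, \<delta>) d. {f \<in> dgHom P M N d. \<forall>g\<in>G.
        dgComp P M N (rho g N) d 0 (\<delta> g) f =
        dgComp P M (rho g M) (rho g N) 0 d (rho_map g f) (\<epsilon> g)}),
      dgScl = dgScl P,
      dgDif = (\<lambda>(M, \<epsilon>) (N, \<delta>). dgDif P M N),
      dgComp = (\<lambda>(M, \<epsilon>) (N, \<delta>) (Q, \<zeta>). dgComp P M N Q),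
      dgId = (\<lambda>(M, \<epsilon>). dgId P M)\<rparr>)"


section \<open>The Grothendieck ring of geometric dg categories\<close>

type_synonym 'k gen = "'k dgc set"
type_synonym 'k K0_elem = "('k gen \<Rightarrow>\<^sub>0 int) set"

definition generators :: "'k::field gen set" where
  "generators = {qclass V | V :: 'k dgc. geometric V}"

definition gen_elem :: "'k gen \<Rightarrow> ('k gen \<Rightarrow>\<^sub>0 int)" where
  "gen_elem a = Poly_Mapping.single a 1"

text \<open>That the two components are again geometric is automatic.\<close>

definition K0_relators :: "('k::field gen \<Rightarrow>\<^sub>0 int) set" where
  "K0_relators =
     {gen_elem (qclass V) - (gen_elem (qclass (dg_full V A)) + gen_elem (qclass (dg_full V B)))
      | (V :: 'k dgc) A B.
        geometric V \<and> geometric (dg_full V A) \<and> geometric (dg_full V B) \<and>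
        admissible (homotopy_cat V) A \<and> admissible (homotopy_cat V) B \<and>
        semiorthogonal (homotopy_cat V) A B}"

definition K0_relations :: "('k::field gen \<Rightarrow>\<^sub>0 int) set" where
  "K0_relations = generate (free_Abelian_group generators) K0_relators"

definition K0_group :: "'k::field K0_elem monoid" where
  "K0_group = free_Abelian_group generators Mod K0_relations"

text \<open>
  The product: on classes of dg categories by the completed tensor product, then biadditively on
  the free abelian group, then on cosets. As usual for quotients, the value on classes is the
  union over all representatives.
\<close>

definition gen_mult :: "'k::field gen \<Rightarrow> 'k gen \<Rightarrow> 'k gen" where
  "gen_mult a b = (\<Union>V\<in>a. \<Union>W\<in>b. qclass (dg_box V W))"

definition free_mult :: "('k::field gen \<Rightarrow>\<^sub>0 int) \<Rightarrow> ('k gen \<Rightarrow>\<^sub>0 int) \<Rightarrow> ('k gen \<Rightarrow>\<^sub>0 int)" where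
  "free_mult x y = (\<Sum>a\<in>Poly_Mapping.keys x. \<Sum>b\<in>Poly_Mapping.keys y.
     Poly_Mapping.single (gen_mult a b) (Poly_Mapping.lookup x a * Poly_Mapping.lookup y b))"

definition K0_coset :: "('k::field gen \<Rightarrow>\<^sub>0 int) \<Rightarrow> 'k K0_elem" where
  "K0_coset x = K0_relations #>\<^bsub>free_Abelian_group generators\<^esub> x"

definition K0_class :: "('o, 'm::ab_group_add, 'k::field) dgcat \<Rightarrow> 'k K0_elem" where
  "K0_class X = K0_coset (gen_elem (qclass X))"

definition K0 :: "'k::field K0_elem ring" where
  "K0 =
     \<lparr>carrier = carrier K0_group,
      mult = (\<lambda>X Y. \<Union>x\<in>X. \<Union>y\<in>Y. K0_coset (free_mult x y)),
      one = K0_class (dg_Perf (dg_tensor ([] :: 'k dgc list))),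
      zero = monoid.one K0_group,
      add = monoid.mult K0_group\<rparr>"


section \<open>Power series, pre-lambda-structures and power structures\<close>

type_synonym 'a pseries = "nat \<Rightarrow> 'a"

definition ps_one :: "('a, 'b) ring_scheme \<Rightarrow> 'a pseries" where
  "ps_one R = (\<lambda>n. if n = 0 then \<one>\<^bsub>R\<^esub> else \<zero>\<^bsub>R\<^esub>)"

definition ps_mult :: "('a, 'b) ring_scheme \<Rightarrow> 'a pseries \<Rightarrow> 'a pseries \<Rightarrow> 'a pseries" where
  "ps_mult R f g = (\<lambda>n. \<Oplus>\<^bsub>R\<^esub>i\<in>{..n}. f i \<otimes>\<^bsub>R\<^esub> g (n - i))"

text \<open>The series \<open>f(t\<^sup>i)\<close>, for \<open>i \<ge> 1\<close>.\<close>

definition ps_subst_power :: "('a, 'b) ring_scheme \<Rightarrow> nat \<Rightarrow> 'a pseries \<Rightarrow> 'a pseries" where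
  "ps_subst_power R i f = (\<lambda>n. if i dvd n then f (n div i) else \<zero>\<^bsub>R\<^esub>)"

definition ps_one_minus_power :: "('a, 'b) ring_scheme \<Rightarrow> nat \<Rightarrow> 'a pseries" where
  "ps_one_minus_power R n =
     (\<lambda>j. if j = 0 then \<one>\<^bsub>R\<^esub> else if j = n then \<ominus>\<^bsub>R\<^esub> \<one>\<^bsub>R\<^esub> else \<zero>\<^bsub>R\<^esub>)"

definition ps_inverse :: "('a, 'b) ring_scheme \<Rightarrow> 'a pseries \<Rightarrow> 'a pseries" where
  "ps_inverse R f = (THE g. range g \<subseteq> carrier R \<and> ps_mult R f g = ps_one R)"

primrec ps_partial_prod :: "('a, 'b) ring_scheme \<Rightarrow> (nat \<Rightarrow> 'a pseries) \<Rightarrow> nat \<Rightarrow> 'a pseries" where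
  "ps_partial_prod R F 0 = ps_one R"
| "ps_partial_prod R F (Suc N) = ps_mult R (ps_partial_prod R F N) (F (Suc N))"

text \<open>\<open>P\<close> is the product of \<open>F 1, F 2, \<dots>\<close>, the partial products converging to it \<open>t\<close>-adically.\<close>

definition ps_has_prod :: "('a, 'b) ring_scheme \<Rightarrow> (nat \<Rightarrow> 'a pseries) \<Rightarrow> 'a pseries \<Rightarrow> bool" where
  "ps_has_prod R F P \<longleftrightarrow> (\<forall>n. \<exists>N0. \<forall>N\<ge>N0. ps_partial_prod R F N n = P n)"

text \<open>
  The power \<open>A(t)\<^sup>m\<close> in the power structure induced by a pre-lambda-structure \<open>\<lambda>\<close>: if
  \<open>A(t) = \<Prod>\<^sub>i \<lambda>\<^bsub>r\<^sub>i\<^esub>(t\<^sup>i)\<close>, then \<open>A(t)\<^sup>m = \<Prod>\<^sub>i \<lambda>\<^bsub>m r\<^sub>i\<^esub>(t\<^sup>i)\<close>.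
\<close>

definition ps_power ::
  "('a, 'b) ring_scheme \<Rightarrow> ('a \<Rightarrow> 'a pseries) \<Rightarrow> 'a pseries \<Rightarrow> 'a \<Rightarrow> 'a pseries" where
  "ps_power R lam A m = (THE B. \<exists>r. (\<forall>i\<ge>1. r i \<in> carrier R) \<and>
     ps_has_prod R (\<lambda>i. ps_subst_power R i (lam (r i))) A \<and>
     ps_has_prod R (\<lambda>i. ps_subst_power R i (lam (m \<otimes>\<^bsub>R\<^esub> r i))) B)"

definition partition_number :: "nat \<Rightarrow> nat" where
  "partition_number k = card {p :: nat multiset. 0 \<notin># p \<and> sum_mset p = k}"

definition two_lambda_ring :: "('a, 'b) ring_scheme \<Rightarrow> (nat \<Rightarrow> 'a \<Rightarrow> 'a) \<Rightarrow> bool" where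
  "two_lambda_ring R S \<longleftrightarrow>
     cring R \<and>
     (\<forall>k. \<forall>m\<in>carrier R. S k m \<in> carrier R) \<and>
     (\<forall>m\<in>carrier R. S 0 m = \<one>\<^bsub>R\<^esub> \<and> S 1 m = m) \<and>
     (\<forall>k. \<forall>m\<in>carrier R. \<forall>n\<in>carrier R.
        S k (m \<oplus>\<^bsub>R\<^esub> n) = (\<Oplus>\<^bsub>R\<^esub>l\<in>{..k}. S l m \<otimes>\<^bsub>R\<^esub> S (k - l) n)) \<and>
     (\<forall>k. S k \<one>\<^bsub>R\<^esub> = [partition_number k] \<cdot>\<^bsub>R\<^esub> \<one>\<^bsub>R\<^esub>)"

text \<open>
  The operations \<open>Sym\<^sup>n\<close> on \<open>K\<^sub>0\<close>: the 2-lambda-ring structure given by the symmetric powers on the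
  classes of geometric dg categories. As these classes generate \<open>K\<^sub>0\<close>, there is at most one such
  structure.
\<close>

definition Sym_operations :: "(nat \<Rightarrow> 'k::field K0_elem \<Rightarrow> 'k K0_elem) \<Rightarrow> bool" where
  "Sym_operations S \<longleftrightarrow>
     two_lambda_ring K0 S \<and>
     (\<forall>n (V :: 'k dgc). geometric V \<longrightarrow> S n (K0_class V) = K0_class (dg_Sym n V))"

definition Z_cat :: "(nat \<Rightarrow> 'k::field K0_elem \<Rightarrow> 'k K0_elem) \<Rightarrow> 'k K0_elem \<Rightarrow> 'k K0_elem pseries" where
  "Z_cat S M = (\<lambda>k. S k M)"

end

theory Submission
  imports Defs
begin

text \<open>
  Write \<open>1/(1 - t) = \<Prod>\<^sub>i \<lambda>\<^bsub>a\<^sub>i\<^esub>(t\<^sup>i)\<close>. Substituting \<open>t\<^sup>n\<close> gives the expansion of \<open>1/(1 - t\<^sup>n)\<close>, and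
  multiplying over \<open>n\<close> gives \<open>\<Prod>\<^sub>n 1/(1 - t\<^sup>n) = \<Prod>\<^sub>j \<lambda>\<^bsub>c\<^sub>j\<^esub>(t\<^sup>j)\<close> with \<open>c\<^sub>j\<close> the sum of \<open>a\<^sub>i\<close> over the
  divisors \<open>i\<close> of \<open>j\<close>. By Euler's product for the partition numbers the left-hand side is
  \<open>\<lambda>\<^sub>1(t)\<close>, so uniqueness of expansions forces \<open>c\<^sub>1 = 1\<close> and \<open>c\<^sub>j = 0\<close> for \<open>j > 1\<close> (so \<open>a\<close> is the Moebius
  function). Raising to the power \<open>M\<close> replaces \<open>a\<^sub>i\<close> by \<open>M a\<^sub>i\<close>, hence \<open>c\<^sub>j\<close> by \<open>M c\<^sub>j\<close>, and
  the product becomes \<open>\<lambda>\<^sub>M(t)\<close>.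
\<close>

text \<open>Fubini for finite products, by splitting one element off \<open>A\<close>. It is applied
  in the group of series to exchange the two indices of a double product.\<close>

lemma (in comm_monoid) finprod_swap:
  assumes "finite A" "finite B" "\<And>x y. x \<in> A \<Longrightarrow> y \<in> B \<Longrightarrow> f x y \<in> carrier G"
  shows "(\<Otimes>x\<in>A. \<Otimes>y\<in>B. f x y) = (\<Otimes>y\<in>B. \<Otimes>x\<in>A. f x y)"
  using assms(1,3)
proof (induction A rule: finite_induct)
  case (insert a A)
  have "(\<Otimes>y\<in>B. \<Otimes>x\<in>insert a A. f x y) = (\<Otimes>y\<in>B. f a y \<otimes> (\<Otimes>x\<in>A. f x y))"
    using insert by (intro finprod_cong') (auto simp: Pi_def)
  also have "\<dots> = (\<Otimes>y\<in>B. f a y) \<otimes> (\<Otimes>y\<in>B. \<Otimes>x\<in>A. f x y)"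
    using insert by (intro finprod_multf) (auto simp: Pi_def)
  finally show ?case
    using insert by (simp add: Pi_def)
qed simp

section \<open>The group of power series with constant term one\<close>

text \<open>Presenting 1 + tR[[t]] as a monoid record makes \<open>finprod\<close>, group inverses
  and \<open>group_hom\<close> available for products of series.\<close>

definition ps_unit_group :: "('a, 'b) ring_scheme \<Rightarrow> 'a pseries monoid" where
  "ps_unit_group R =
     \<lparr>carrier = {f. range f \<subseteq> carrier R \<and> f 0 = \<one>\<^bsub>R\<^esub>}, mult = ps_mult R, one = ps_one R\<rparr>"

context cring
begin

lemma ps_mult_closed:
  assumes "range f \<subseteq> carrier R" "range g \<subseteq> carrier R"
  shows "range (ps_mult R f g) \<subseteq> carrier R"
  using assms by (auto simp: ps_mult_def image_subset_iff intro!: finsum_closed)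

text \<open>Both sides sum f j * g i * h (m - j - i) over the triangle j + i \<le> n, by diagonals
  and by rows. Keeping the coefficient index \<open>m\<close> apart from the bound \<open>n\<close>
  lets the induction enlarge the triangle while \<open>h\<close> stays put; associativity is the
  case n = m.\<close>

lemma finsum_triangle_assoc:
  fixes f g h :: "nat \<Rightarrow> 'a"
  assumes f: "\<And>i. f i \<in> carrier R" and g: "\<And>i. g i \<in> carrier R" and h: "\<And>i. h i \<in> carrier R"
    and "n \<le> m"
  shows "(\<Oplus>k\<in>{..n}. (\<Oplus>j\<in>{..k}. f j \<otimes> g (k - j)) \<otimes> h (m - k)) =
    (\<Oplus>j\<in>{..n}. f j \<otimes> (\<Oplus>i\<in>{..n - j}. g i \<otimes> h (m - j - i)))"
  using \<open>n \<le> m\<close>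
proof (induction n)
  case 0
  then show ?case using f g h by (simp add: m_assoc)
next
  case (Suc n)
  \<comment> \<open>Row j gains the entry i = Suc n - j. On this new diagonal the factor of
    \<open>h\<close> is h (m - Suc n) for every j, so it can be pulled out.\<close>
  have *: "(\<Oplus>j\<in>{..n}. f j \<otimes> (\<Oplus>i\<in>{..Suc n - j}. g i \<otimes> h (m - j - i)))
    = (\<Oplus>j\<in>{..n}. (f j \<otimes> g (Suc n - j)) \<otimes> h (m - Suc n)
        \<oplus> f j \<otimes> (\<Oplus>i\<in>{..n - j}. g i \<otimes> h (m - j - i)))"
  proof (intro finsum_cong' refl)
    fix j assume "j \<in> {..n}"
    then have "Suc n - j = Suc (n - j)" "m - j - Suc (n - j) = m - Suc n"
      using Suc.prems by auto
    then show "f j \<otimes> (\<Oplus>i\<in>{..Suc n - j}. g i \<otimes> h (m - j - i)) =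
        (f j \<otimes> g (Suc n - j)) \<otimes> h (m - Suc n)
        \<oplus> f j \<otimes> (\<Oplus>i\<in>{..n - j}. g i \<otimes> h (m - j - i))"
      using f g h by (simp add: r_distr m_assoc)
  qed (use f g h in auto)
  have "(\<Oplus>k\<in>{..Suc n}. (\<Oplus>j\<in>{..k}. f j \<otimes> g (k - j)) \<otimes> h (m - k)) =
     (f (Suc n) \<otimes> g 0 \<oplus> (\<Oplus>j\<in>{..n}. f j \<otimes> g (Suc n - j))) \<otimes> h (m - Suc n)
     \<oplus> (\<Oplus>j\<in>{..n}. f j \<otimes> (\<Oplus>i\<in>{..n - j}. g i \<otimes> h (m - j - i)))"
    using Suc f g h by simp
  also have "\<dots> = f (Suc n) \<otimes> (g 0 \<otimes> h (m - Suc n)) \<oplus>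
     ((\<Oplus>j\<in>{..n}. (f j \<otimes> g (Suc n - j)) \<otimes> h (m - Suc n))
     \<oplus> (\<Oplus>j\<in>{..n}. f j \<otimes> (\<Oplus>i\<in>{..n - j}. g i \<otimes> h (m - j - i))))"
    using f g h by (simp add: l_distr m_assoc a_assoc finsum_ldistr)
  also have "\<dots> = (\<Oplus>j\<in>{..Suc n}. f j \<otimes> (\<Oplus>i\<in>{..Suc n - j}. g i \<otimes> h (m - j - i)))"
    using f g h Suc.prems by (subst finsum_Suc) (simp_all add: * finsum_addf del: diff_diff_left)
  finally show ?case .
qed

lemma ps_mult_assoc:
  assumes "range f \<subseteq> carrier R" "range g \<subseteq> carrier R" "range h \<subseteq> carrier R"
  shows "ps_mult R (ps_mult R f g) h = ps_mult R f (ps_mult R g h)"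
  unfolding ps_mult_def
  by (intro ext finsum_triangle_assoc) (use assms in auto)

lemma ps_mult_comm:
  assumes "range f \<subseteq> carrier R" "range g \<subseteq> carrier R"
  shows "ps_mult R f g = ps_mult R g f"
proof
  fix n :: nat
  have f: "f i \<in> carrier R" and g: "g i \<in> carrier R" for i
    using assms by auto
  have "bij_betw (\<lambda>i. n - i) {..n} {..n}"
    by (rule bij_betwI[where g = "\<lambda>i. n - i"]) auto
  then have "(\<Oplus>i\<in>{..n}. g i \<otimes> f (n - i)) = (\<Oplus>i\<in>{..n}. g (n - i) \<otimes> f (n - (n - i)))"
    using finsum_reindex[of "\<lambda>i. g i \<otimes> f (n - i)" "\<lambda>i. n - i" "{..n}"] f g
    by (auto simp: bij_betw_def)
  also have "\<dots> = (\<Oplus>i\<in>{..n}. f i \<otimes> g (n - i))"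
    using f g by (intro finsum_cong') (auto simp: m_comm)
  finally show "ps_mult R f g n = ps_mult R g f n"
    by (simp add: ps_mult_def)
qed

lemma ps_mult_zero_coeff:
  assumes "range f \<subseteq> carrier R" "range g \<subseteq> carrier R"
  shows "ps_mult R f g 0 = f 0 \<otimes> g 0"
  using assms by (auto simp: ps_mult_def image_subset_iff)

text \<open>As g = 1 + g n t^n + ..., only the summands i = 0 and i = n survive.\<close>

lemma ps_mult_top_coeffs:
  assumes "range f \<subseteq> carrier R" "range g \<subseteq> carrier R" "f 0 = \<one>" "g 0 = \<one>"
    and "0 < n" and g0: "\<And>k. 0 < k \<Longrightarrow> k < n \<Longrightarrow> g k = \<zero>"
  shows "ps_mult R f g n = f n \<oplus> g n"
proof -
  have f: "f i \<in> carrier R" and g: "g i \<in> carrier R" for i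
    using assms by auto
  have "ps_mult R f g n = (\<Oplus>i\<in>{0, n}. f i \<otimes> g (n - i))"
    unfolding ps_mult_def
    by (rule add.finprod_mono_neutral_cong_right) (use f g g0 in auto)
  then show ?thesis
    using assms f g by (simp add: a_comm)
qed

lemma ps_mult_one:
  assumes "range f \<subseteq> carrier R"
  shows "ps_mult R (ps_one R) f = f"
proof
  fix n :: nat
  have f: "f i \<in> carrier R" for i
    using assms by auto
  have "ps_mult R (ps_one R) f n = (\<Oplus>i\<in>{0}. ps_one R i \<otimes> f (n - i))"
    unfolding ps_mult_def
    by (rule add.finprod_mono_neutral_cong_right) (use f in \<open>auto simp: ps_one_def\<close>)
  then show "ps_mult R (ps_one R) f n = f n"
    using f by (simp add: ps_one_def)
qed

lemma ps_one_in_unit_group: "ps_one R \<in> carrier (ps_unit_group R)"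
  by (auto simp: ps_unit_group_def ps_one_def)

text \<open>The inner conditional is vacuous; it lets the termination proof see that \<open>i < n\<close>.\<close>

fun ps_inverse_coeff :: "'a pseries \<Rightarrow> nat \<Rightarrow> 'a" where
  "ps_inverse_coeff f n =
     (if n = 0 then \<one>
      else \<ominus> (\<Oplus>i\<in>{..<n}. (if i < n then ps_inverse_coeff f i else \<zero>) \<otimes> f (n - i)))"

declare ps_inverse_coeff.simps [simp del]

lemma ps_inverse_coeff_closed:
  assumes "range f \<subseteq> carrier R"
  shows "ps_inverse_coeff f n \<in> carrier R"
proof (induction n rule: less_induct)
  case (less n)
  then show ?case
    using assms by (subst ps_inverse_coeff.simps) (auto simp: image_subset_iff intro!: a_inv_closed finsum_closed)
qed

text \<open>The recursion is coefficient n of g f = 1 solved for the summand i = n, whose second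
  factor is f 0 = 1.\<close>

lemma ps_mult_inverse_coeff:
  assumes f: "range f \<subseteq> carrier R" "f 0 = \<one>"
  shows "ps_mult R (ps_inverse_coeff f) f = ps_one R"
proof
  fix n :: nat
  let ?g = "ps_inverse_coeff f"
  have cl: "?g i \<in> carrier R" "f i \<in> carrier R" for i
    using f ps_inverse_coeff_closed by auto
  show "ps_mult R ?g f n = ps_one R n"
  proof (cases "n = 0")
    case True
    then show ?thesis
      using f cl by (simp add: ps_mult_def ps_one_def) (simp add: ps_inverse_coeff.simps)
  next
    case False
    have "(\<Oplus>i\<in>{..<n}. (if i < n then ?g i else \<zero>) \<otimes> f (n - i)) = (\<Oplus>i\<in>{..<n}. ?g i \<otimes> f (n - i))"
      using cl by (intro finsum_cong') auto
    then have "?g n = \<ominus> (\<Oplus>i\<in>{..<n}. ?g i \<otimes> f (n - i))"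
      using False by (subst ps_inverse_coeff.simps) simp
    moreover have "ps_mult R ?g f n = ?g n \<otimes> f 0 \<oplus> (\<Oplus>i\<in>{..<n}. ?g i \<otimes> f (n - i))"
      unfolding ps_mult_def using cl by (subst add.finprod_Suc3) auto
    ultimately show ?thesis
      using False f cl by (simp add: ps_one_def l_neg)
  qed
qed

lemma comm_group_ps_unit_group: "comm_group (ps_unit_group R)"
proof (rule comm_groupI)
  fix f assume "f \<in> carrier (ps_unit_group R)"
  then have f: "range f \<subseteq> carrier R" "f 0 = \<one>"
    by (auto simp: ps_unit_group_def)
  have "ps_inverse_coeff f \<in> carrier (ps_unit_group R)"
    using ps_inverse_coeff_closed[OF f(1)]
    by (auto simp: ps_unit_group_def) (simp add: ps_inverse_coeff.simps)
  then show "\<exists>g\<in>carrier (ps_unit_group R). g \<otimes>\<^bsub>ps_unit_group R\<^esub> f = \<one>\<^bsub>ps_unit_group R\<^esub>"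
    using ps_mult_inverse_coeff[OF f] by (auto simp: ps_unit_group_def)
qed (use ps_mult_closed ps_mult_assoc ps_mult_comm ps_mult_one ps_one_in_unit_group
      in \<open>auto simp: ps_unit_group_def ps_mult_zero_coeff\<close>)

text \<open>The rewrites let the group facts speak of \<open>ps_mult R\<close> and
  \<open>ps_one R\<close> directly.\<close>

sublocale U: comm_group "ps_unit_group R"
  rewrites "mult (ps_unit_group R) = ps_mult R" and "one (ps_unit_group R) = ps_one R"
  using comm_group_ps_unit_group by (simp_all add: ps_unit_group_def)

text \<open>Comparing constant coefficients in f g = 1 forces g 0 = 1, so every candidate of the
  \<open>THE\<close> already lies in the group, where inverses are unique.\<close>

lemma ps_inverse_eq_m_inv:
  assumes f: "f \<in> carrier (ps_unit_group R)"
  shows "ps_inverse R f = inv\<^bsub>ps_unit_group R\<^esub> f"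
  unfolding ps_inverse_def
proof (rule the_equality)
  show "range (inv\<^bsub>ps_unit_group R\<^esub> f) \<subseteq> carrier R \<and> ps_mult R f (inv\<^bsub>ps_unit_group R\<^esub> f) = ps_one R"
    using U.inv_closed[OF f] U.r_inv[OF f] by (auto simp: ps_unit_group_def)
next
  fix g assume g: "range g \<subseteq> carrier R \<and> ps_mult R f g = ps_one R"
  then have "g 0 = ps_mult R f g 0"
    using f by (subst ps_mult_zero_coeff) (auto simp: ps_unit_group_def image_subset_iff)
  then have "g \<in> carrier (ps_unit_group R)"
    using g by (auto simp: ps_unit_group_def ps_one_def)
  then show "g = inv\<^bsub>ps_unit_group R\<^esub> f"
    using f g U.inv_equality U.m_comm by metis
qed

end

section \<open>Infinite products of power series\<close>

text \<open>Congruence modulo t^(n+1), used to replace infinite products by finite ones.\<close>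

definition ps_agree :: "nat \<Rightarrow> 'a pseries \<Rightarrow> 'a pseries \<Rightarrow> bool" where
  "ps_agree n f g \<longleftrightarrow> (\<forall>k\<le>n. f k = g k)"

text \<open>The diagonal of the partial products: for a multipliable family coefficient n no longer
  changes after n factors, so this is the t-adic limit.\<close>

definition ps_tprod :: "('a, 'b) ring_scheme \<Rightarrow> (nat \<Rightarrow> 'a pseries) \<Rightarrow> 'a pseries" where
  "ps_tprod R F = (\<lambda>n. ps_partial_prod R F n n)"

text \<open>The factor \<open>F i\<close> is 1 modulo t^i; indices start at 1 as in
  \<open>ps_partial_prod\<close>.\<close>

definition ps_multipliable :: "('a, 'b) ring_scheme \<Rightarrow> (nat \<Rightarrow> 'a pseries) \<Rightarrow> bool" where
  "ps_multipliable R F \<longleftrightarrow> (\<forall>i\<ge>1. F i \<in> carrier (ps_unit_group R) \<and> (\<forall>k. 0 < k \<longrightarrow> k < i \<longrightarrow> F i k = \<zero>\<^bsub>R\<^esub>))"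

lemma ps_agree_refl [simp]: "ps_agree n f f"
  by (simp add: ps_agree_def)

lemma ps_agree_sym: "ps_agree n f g \<Longrightarrow> ps_agree n g f"
  by (simp add: ps_agree_def)

lemma ps_agree_trans [trans]: "ps_agree n f g \<Longrightarrow> ps_agree n g h \<Longrightarrow> ps_agree n f h"
  by (simp add: ps_agree_def)

lemma ps_agreeD: "ps_agree n f g \<Longrightarrow> f n = g n"
  by (simp add: ps_agree_def)

lemma ps_partial_prod_cong:
  "(\<And>i. 1 \<le> i \<Longrightarrow> F i = G i) \<Longrightarrow> ps_partial_prod R F n = ps_partial_prod R G n"
  by (induction n) auto

lemma ps_tprod_cong: "(\<And>i. 1 \<le> i \<Longrightarrow> F i = G i) \<Longrightarrow> ps_tprod R F = ps_tprod R G"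
  using ps_partial_prod_cong[of F G R] by (simp add: ps_tprod_def)

lemma ps_has_prod_cong:
  "(\<And>i. 1 \<le> i \<Longrightarrow> F i = G i) \<Longrightarrow> ps_has_prod R F P = ps_has_prod R G P"
  using ps_partial_prod_cong[of F G R] by (simp add: ps_has_prod_def)

context cring
begin

lemma ps_unit_group_mult: "mult (ps_unit_group R) = ps_mult R"
  by (simp add: ps_unit_group_def)

lemma unit_group_coeff: "f \<in> carrier (ps_unit_group R) \<Longrightarrow> f k \<in> carrier R"
  by (auto simp: ps_unit_group_def)

lemma unit_group_range: "f \<in> carrier (ps_unit_group R) \<Longrightarrow> range f \<subseteq> carrier R"
  by (auto simp: ps_unit_group_def)

lemma unit_group_zero: "f \<in> carrier (ps_unit_group R) \<Longrightarrow> f 0 = \<one>"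
  by (auto simp: ps_unit_group_def)

lemma ps_agree_mult:
  assumes "range f' \<subseteq> carrier R" "range g' \<subseteq> carrier R"
    and "ps_agree n f f'" "ps_agree n g g'"
  shows "ps_agree n (ps_mult R f g) (ps_mult R f' g')"
  unfolding ps_agree_def ps_mult_def
  using assms by (auto simp: ps_agree_def image_subset_iff intro!: finsum_cong')

lemma ps_agree_finprod:
  assumes "\<And>x. x \<in> A \<Longrightarrow> f x \<in> carrier (ps_unit_group R)"
    and "\<And>x. x \<in> A \<Longrightarrow> g x \<in> carrier (ps_unit_group R)"
    and "\<And>x. x \<in> A \<Longrightarrow> ps_agree n (f x) (g x)"
  shows "ps_agree n (finprod (ps_unit_group R) f A) (finprod (ps_unit_group R) g A)"
  using assms
proof (induction A rule: infinite_finite_induct)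
  case (insert a A)
  then have "f \<in> A \<rightarrow> carrier (ps_unit_group R)" "g \<in> A \<rightarrow> carrier (ps_unit_group R)"
    by auto
  with insert show ?case
    by (simp add: ps_agree_mult unit_group_range U.finprod_closed)
qed auto

lemma ps_partial_prod_eq_finprod:
  assumes "\<And>i. 1 \<le> i \<Longrightarrow> i \<le> N \<Longrightarrow> F i \<in> carrier (ps_unit_group R)"
  shows "ps_partial_prod R F N = finprod (ps_unit_group R) F {1..N}"
  using assms
proof (induction N)
  case (Suc N)
  have "finprod (ps_unit_group R) F {1..Suc N} = ps_mult R (F (Suc N)) (finprod (ps_unit_group R) F {1..N})"
    using Suc.prems by (simp add: atLeastAtMostSuc_conv Pi_def)
  with Suc show ?case
    by (simp add: U.m_comm Pi_def)
qed simp

lemma ps_partial_prod_closed: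
  assumes "\<And>i. 1 \<le> i \<Longrightarrow> i \<le> N \<Longrightarrow> F i \<in> carrier (ps_unit_group R)"
  shows "ps_partial_prod R F N \<in> carrier (ps_unit_group R)"
  using assms by (simp add: ps_partial_prod_eq_finprod Pi_def U.finprod_closed)

text \<open>Every factor beyond the n-th is 1 modulo t^(n+1) and leaves the coefficients up to n
  alone.\<close>

lemma ps_partial_prod_stable:
  assumes F: "ps_multipliable R F" and "n \<le> N"
  shows "ps_agree n (ps_partial_prod R F N) (ps_partial_prod R F n)"
  using \<open>n \<le> N\<close>
proof (induction N rule: dec_induct)
  case (step N)
  have cl: "ps_partial_prod R F N \<in> carrier (ps_unit_group R)"
    using F by (intro ps_partial_prod_closed) (simp add: ps_multipliable_def)
  have "ps_agree n (F (Suc N)) (ps_one R)"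
    using F step.hyps by (auto simp: ps_agree_def ps_one_def ps_multipliable_def ps_unit_group_def)
  then have "ps_agree n (ps_partial_prod R F (Suc N)) (ps_mult R (ps_partial_prod R F N) (ps_one R))"
    using cl U.one_closed unfolding ps_partial_prod.simps
    by (intro ps_agree_mult ps_agree_refl unit_group_range)
  also have "ps_mult R (ps_partial_prod R F N) (ps_one R) = ps_partial_prod R F N"
    using cl by simp
  finally show ?case
    using step.IH ps_agree_trans by blast
qed simp

lemma ps_partial_prod_agree_tprod:
  assumes "ps_multipliable R F" and "n \<le> N"
  shows "ps_agree n (ps_partial_prod R F N) (ps_tprod R F)"
proof -
  have "ps_partial_prod R F N k = ps_partial_prod R F k k" if "k \<le> n" for k
    using ps_partial_prod_stable[OF assms(1), of k N] that assms(2) by (simp add: ps_agree_def)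
  then show ?thesis
    by (simp add: ps_agree_def ps_tprod_def)
qed

lemma ps_has_prod_iff_tprod:
  assumes "ps_multipliable R F"
  shows "ps_has_prod R F P \<longleftrightarrow> P = ps_tprod R F"
proof -
  have *: "ps_partial_prod R F N n = ps_tprod R F n" if "n \<le> N" for n N
    using ps_partial_prod_agree_tprod[OF assms that] by (rule ps_agreeD)
  show ?thesis
  proof
    assume P: "ps_has_prod R F P"
    show "P = ps_tprod R F"
    proof
      fix n :: nat
      obtain N0 where "\<forall>N\<ge>N0. ps_partial_prod R F N n = P n"
        using P by (auto simp: ps_has_prod_def)
      then show "P n = ps_tprod R F n"
        using *[of n "max n N0"] by simp
    qed
  qed (use * in \<open>auto simp: ps_has_prod_def\<close>)
qed

lemma ps_tprod_closed:
  assumes "ps_multipliable R F"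
  shows "ps_tprod R F \<in> carrier (ps_unit_group R)"
proof -
  have "ps_partial_prod R F n \<in> carrier (ps_unit_group R)" for n
    using assms by (intro ps_partial_prod_closed) (simp add: ps_multipliable_def)
  then show ?thesis
    by (auto simp: ps_tprod_def ps_unit_group_def simp del: ps_partial_prod.simps)
qed

section \<open>Substituting t^i for t, in series and in infinite products\<close>

lemma ps_subst_power_mult:
  assumes "1 \<le> i" "range f \<subseteq> carrier R" "range g \<subseteq> carrier R"
  shows "ps_subst_power R i (ps_mult R f g) = ps_mult R (ps_subst_power R i f) (ps_subst_power R i g)"
proof
  fix n :: nat
  have cl: "f k \<in> carrier R" "g k \<in> carrier R" for k
    using assms by auto
  \<comment> \<open>A summand is nonzero only if i divides both k and n - k. This forces i to divide
    n, and then leaves exactly the multiples k of i.\<close>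
  have dv: "i dvd n - k \<longleftrightarrow> i dvd n" if "i dvd k" "k \<le> n" for k
    using that by (metis dvd_add_left_iff le_add_diff_inverse2)
  show "ps_subst_power R i (ps_mult R f g) n = ps_mult R (ps_subst_power R i f) (ps_subst_power R i g) n"
  proof (cases "i dvd n")
    case False
    then have "ps_mult R (ps_subst_power R i f) (ps_subst_power R i g) n = \<zero>"
      unfolding ps_mult_def
      by (intro add.finprod_one_eqI) (use cl dv in \<open>auto simp: ps_subst_power_def\<close>)
    with False show ?thesis
      by (simp add: ps_subst_power_def)
  next
    case True
    then obtain m where m: "n = i * m" ..
    have "ps_mult R (ps_subst_power R i f) (ps_subst_power R i g) n =
       (\<Oplus>k\<in>(*) i ` {..m}. ps_subst_power R i f k \<otimes> ps_subst_power R i g (n - k))"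
      unfolding ps_mult_def
    proof (rule add.finprod_mono_neutral_cong_right)
      fix k assume "k \<in> {..n} - (*) i ` {..m}"
      then have "\<not> i dvd k"
        using assms(1) by (auto simp: m elim!: dvdE)
      then show "ps_subst_power R i f k \<otimes> ps_subst_power R i g (n - k) = \<zero>"
        using cl by (simp add: ps_subst_power_def)
    qed (use cl assms(1) in \<open>auto simp: ps_subst_power_def m\<close>)
    also have "\<dots> = (\<Oplus>k\<in>{..m}. ps_subst_power R i f (i * k) \<otimes> ps_subst_power R i g (n - i * k))"
      using cl assms(1) by (intro finsum_reindex) (auto simp: inj_on_def ps_subst_power_def)
    also have "\<dots> = (\<Oplus>k\<in>{..m}. f k \<otimes> g (m - k))"
      using cl assms(1)
      by (intro finsum_cong') (auto simp: ps_subst_power_def m simp flip: diff_mult_distrib2)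
    finally show ?thesis
      using assms(1) by (simp add: ps_subst_power_def ps_mult_def m)
  qed
qed

lemma ps_subst_power_one: "1 \<le> i \<Longrightarrow> ps_subst_power R i (ps_one R) = ps_one R"
  by (auto simp: ps_subst_power_def ps_one_def fun_eq_iff elim!: dvdE)

lemma ps_subst_power_closed:
  "1 \<le> i \<Longrightarrow> f \<in> carrier (ps_unit_group R) \<Longrightarrow> ps_subst_power R i f \<in> carrier (ps_unit_group R)"
  by (auto simp: ps_subst_power_def ps_unit_group_def)

lemma ps_subst_power_subst_power:
  "1 \<le> i \<Longrightarrow> 1 \<le> j \<Longrightarrow> ps_subst_power R i (ps_subst_power R j f) = ps_subst_power R (i * j) f"
  by (auto simp: ps_subst_power_def fun_eq_iff div_mult2_eq elim!: dvdE)

lemma ps_subst_power_hom: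
  "1 \<le> i \<Longrightarrow> group_hom (ps_unit_group R) (ps_unit_group R) (ps_subst_power R i)"
  by (intro group_hom.intro U.group_axioms group_hom_axioms.intro homI)
     (simp_all add: ps_unit_group_mult ps_subst_power_closed ps_subst_power_mult unit_group_range)

lemma ps_subst_power_partial_prod:
  assumes "1 \<le> n" and "\<And>i. 1 \<le> i \<Longrightarrow> i \<le> N \<Longrightarrow> F i \<in> carrier (ps_unit_group R)"
  shows "ps_subst_power R n (ps_partial_prod R F N) = ps_partial_prod R (\<lambda>i. ps_subst_power R n (F i)) N"
  using assms(2)
proof (induction N)
  case (Suc N)
  then show ?case
    using assms(1) ps_partial_prod_closed[of N F] by (simp add: ps_subst_power_mult unit_group_range)
qed (use assms(1) in \<open>simp add: ps_subst_power_one\<close>)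

text \<open>Substituting t^n turns the factor \<lambda>(t^i) into \<lambda>(t^(n i)), which belongs
  at position n i of an expansion. The factors are moved there and the gaps filled with 1.\<close>

definition ps_dilate :: "nat \<Rightarrow> (nat \<Rightarrow> 'a pseries) \<Rightarrow> nat \<Rightarrow> 'a pseries" where
  "ps_dilate n F = (\<lambda>j. if n dvd j then ps_subst_power R n (F (j div n)) else ps_one R)"

lemma ps_multipliable_dilate:
  assumes "1 \<le> n" "ps_multipliable R F"
  shows "ps_multipliable R (ps_dilate n F)"
  unfolding ps_multipliable_def
proof (intro allI impI conjI)
  fix i :: nat assume "1 \<le> i"
  then show "ps_dilate n F i \<in> carrier (ps_unit_group R)"
    using assms by (auto simp: ps_dilate_def ps_multipliable_def elim!: dvdE intro!: ps_subst_power_closed)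
next
  fix i k :: nat assume "1 \<le> i" "0 < k" "k < i"
  then show "ps_dilate n F i k = \<zero>"
    using assms by (auto simp: ps_dilate_def ps_multipliable_def ps_subst_power_def ps_one_def elim!: dvdE)
qed

text \<open>At coefficient k both sides are finite products: the first k factors on the left match
  the first n * k positions on the right, where non-multiples of n hold 1.\<close>

lemma ps_subst_power_tprod:
  assumes n: "1 \<le> n" and F: "ps_multipliable R F"
  shows "ps_subst_power R n (ps_tprod R F) = ps_tprod R (ps_dilate n F)"
proof
  fix k
  let ?E = "ps_dilate n F"
  have Fcl: "F i \<in> carrier (ps_unit_group R)" if "1 \<le> i" for i
    using F that by (simp add: ps_multipliable_def)
  have Ecl: "?E i \<in> carrier (ps_unit_group R)" if "1 \<le> i" for i
    using ps_multipliable_dilate[OF assms] that by (simp add: ps_multipliable_def)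
  have "ps_agree k (ps_partial_prod R F k) (ps_tprod R F)"
    using ps_partial_prod_agree_tprod[OF F] by blast
  then have "ps_subst_power R n (ps_tprod R F) k = ps_subst_power R n (ps_partial_prod R F k) k"
    by (simp add: ps_subst_power_def ps_agree_def)
  also have "ps_subst_power R n (ps_partial_prod R F k) =
      finprod (ps_unit_group R) (\<lambda>i. ps_subst_power R n (F i)) {1..k}"
    using n Fcl by (subst ps_subst_power_partial_prod)
      (simp_all add: ps_partial_prod_eq_finprod ps_subst_power_closed)
  also have "\<dots> = finprod (ps_unit_group R) (\<lambda>i. ?E (n * i)) {1..k}"
    using n Fcl by (intro U.finprod_cong') (auto simp: ps_dilate_def intro!: ps_subst_power_closed)
  also have "\<dots> = finprod (ps_unit_group R) ?E ((*) n ` {1..k})"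
    using n Ecl by (intro U.finprod_reindex[symmetric]) (auto simp: inj_on_def)
  also have "\<dots> = finprod (ps_unit_group R) ?E {1..n * k}"
  proof (rule U.finprod_mono_neutral_cong_left)
    fix j assume "j \<in> {1..n * k} - (*) n ` {1..k}"
    then have "\<not> n dvd j"
      using n by (auto elim!: dvdE)
    then show "?E j = ps_one R"
      by (simp add: ps_dilate_def)
  qed (use n Ecl in auto)
  also have "\<dots> = ps_partial_prod R ?E (n * k)"
    using Ecl by (simp add: ps_partial_prod_eq_finprod)
  also have "\<dots> k = ps_tprod R ?E k"
    using n by (intro ps_agreeD ps_partial_prod_agree_tprod ps_multipliable_dilate F) auto
  finally show "ps_subst_power R n (ps_tprod R F) k = ps_tprod R ?E k" .
qed

text \<open>Coefficient k sees only indices up to k, so the exchange reduces to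
  \<open>finprod_swap\<close> on a square. By \<open>low\<close> the factors with n > j are 1, which
  makes the inner product independent of k.\<close>

lemma ps_tprod_swap:
  assumes E: "\<And>n. 1 \<le> n \<Longrightarrow> ps_multipliable R (E n)"
    and low: "\<And>n j. 1 \<le> j \<Longrightarrow> j < n \<Longrightarrow> E n j = ps_one R"
    and mult: "ps_multipliable R (\<lambda>n. ps_tprod R (E n))"
      "ps_multipliable R (\<lambda>j. finprod (ps_unit_group R) (\<lambda>n. E n j) {1..j})"
  shows "ps_tprod R (\<lambda>n. ps_tprod R (E n)) =
    ps_tprod R (\<lambda>j. finprod (ps_unit_group R) (\<lambda>n. E n j) {1..j})"
proof
  fix k
  let ?U = "ps_unit_group R"
  have cl: "E n j \<in> carrier ?U" if "1 \<le> n" "1 \<le> j" for n j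
    using E that by (simp add: ps_multipliable_def)
  have "ps_tprod R (\<lambda>n. ps_tprod R (E n)) k = finprod ?U (\<lambda>n. ps_tprod R (E n)) {1..k} k"
    using E by (simp add: ps_tprod_closed ps_tprod_def[of R "\<lambda>n. ps_tprod R (E n)"] ps_partial_prod_eq_finprod)
  also have "\<dots> = finprod ?U (\<lambda>n. finprod ?U (E n) {1..k}) {1..k} k"
  proof (rule ps_agreeD, rule ps_agree_finprod)
    fix n assume "n \<in> {1..k}"
    then have n: "1 \<le> n" by simp
    show "ps_tprod R (E n) \<in> carrier ?U"
      using E[OF n] by (rule ps_tprod_closed)
    show "finprod ?U (E n) {1..k} \<in> carrier ?U"
      using n cl by (auto intro!: U.finprod_closed)
    show "ps_agree k (ps_tprod R (E n)) (finprod ?U (E n) {1..k})"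
      using ps_partial_prod_agree_tprod[OF E[OF n] order_refl[of k]] ps_partial_prod_eq_finprod[of k "E n"] cl[OF n]
      by (simp add: ps_agree_sym)
  qed
  also have "finprod ?U (\<lambda>n. finprod ?U (E n) {1..k}) {1..k} =
      finprod ?U (\<lambda>j. finprod ?U (\<lambda>n. E n j) {1..k}) {1..k}"
    using cl by (intro U.finprod_swap) auto
  also have "\<dots> = finprod ?U (\<lambda>j. finprod ?U (\<lambda>n. E n j) {1..j}) {1..k}"
  proof (rule U.finprod_cong'[OF refl])
    fix j assume "j \<in> {1..k}"
    then show "finprod ?U (\<lambda>n. E n j) {1..k} = finprod ?U (\<lambda>n. E n j) {1..j}"
      using cl low by (intro U.finprod_mono_neutral_cong_right) auto
  qed (use cl in \<open>auto intro!: U.finprod_closed\<close>)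
  also have "\<dots> k = ps_tprod R (\<lambda>j. finprod ?U (\<lambda>n. E n j) {1..j}) k"
    using cl by (simp add: ps_tprod_def ps_partial_prod_eq_finprod U.finprod_closed Pi_def)
  finally show "ps_tprod R (\<lambda>n. ps_tprod R (E n)) k = \<dots>" .
qed

lemma ps_multipliable_subst_power:
  assumes "\<And>i. 1 \<le> i \<Longrightarrow> f i \<in> carrier (ps_unit_group R)"
  shows "ps_multipliable R (\<lambda>i. ps_subst_power R i (f i))"
  using assms
  by (auto simp: ps_multipliable_def ps_subst_power_closed) (auto simp: ps_subst_power_def dvd_imp_le)

end

section \<open>Expansions with respect to a pre-lambda-structure\<close>

text \<open>The argument is formal in the pre-lambda-structure, so it is carried out for any
  commutative ring; \<open>lam_closed\<close> includes the constant term 1.\<close>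

locale pre_lambda_ring = cring R for R (structure) +
  fixes lam :: "'a \<Rightarrow> 'a pseries"
  assumes lam_closed: "a \<in> carrier R \<Longrightarrow> lam a \<in> carrier (ps_unit_group R)"
    and lam_coeff_one: "a \<in> carrier R \<Longrightarrow> lam a 1 = a"
    and lam_add: "a \<in> carrier R \<Longrightarrow> b \<in> carrier R \<Longrightarrow> lam (a \<oplus> b) = ps_mult R (lam a) (lam b)"
begin

definition lam_prod :: "(nat \<Rightarrow> 'a) \<Rightarrow> 'a pseries" where
  "lam_prod r = ps_tprod R (\<lambda>i. ps_subst_power R i (lam (r i)))"

text \<open>Additivity at 0 + 0 makes \<open>lam \<zero>\<close> idempotent in a group.\<close>

lemma lam_zero: "lam \<zero> = ps_one R"
  using lam_add[of \<zero> \<zero>] U.l_cancel_one[of "lam \<zero>" "lam \<zero>"] by (simp add: lam_closed)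

lemma subst_power_lam_zero: "1 \<le> i \<Longrightarrow> ps_subst_power R i (lam \<zero>) = ps_one R"
  by (simp add: lam_zero ps_subst_power_one)

lemma subst_power_lam_finsum:
  assumes "1 \<le> i" "finite A" "\<And>x. x \<in> A \<Longrightarrow> f x \<in> carrier R"
  shows "ps_subst_power R i (lam (\<Oplus>x\<in>A. f x)) =
    finprod (ps_unit_group R) (\<lambda>x. ps_subst_power R i (lam (f x))) A"
  using assms(2,3)
proof (induction A rule: finite_induct)
  case empty
  then show ?case
    using assms(1) by (simp add: subst_power_lam_zero)
next
  case (insert a A)
  have "finsum R f (insert a A) = f a \<oplus> finsum R f A"
    using insert by (simp add: Pi_def)
  moreover have "finsum R f A \<in> carrier R"
    using insert by (intro finsum_closed) auto
  ultimately have "ps_subst_power R i (lam (finsum R f (insert a A))) =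
      ps_mult R (ps_subst_power R i (lam (f a))) (ps_subst_power R i (lam (finsum R f A)))"
    using insert.prems assms(1) by (simp add: lam_add ps_subst_power_mult lam_closed unit_group_range)
  then show ?case
    using insert assms(1) by (simp add: Pi_def lam_closed ps_subst_power_closed)
qed

lemma multipliable_lam:
  assumes "\<And>i. 1 \<le> i \<Longrightarrow> r i \<in> carrier R"
  shows "ps_multipliable R (\<lambda>i. ps_subst_power R i (lam (r i)))"
  using assms by (intro ps_multipliable_subst_power lam_closed)

lemma lam_prod_closed:
  "(\<And>i. 1 \<le> i \<Longrightarrow> r i \<in> carrier R) \<Longrightarrow> lam_prod r \<in> carrier (ps_unit_group R)"
  unfolding lam_prod_def by (intro ps_tprod_closed multipliable_lam)

lemma lam_prod_cong: "(\<And>i. 1 \<le> i \<Longrightarrow> r i = s i) \<Longrightarrow> lam_prod r = lam_prod s"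
  unfolding lam_prod_def by (intro ps_tprod_cong) simp

lemma has_prod_lam_iff:
  "(\<And>i. 1 \<le> i \<Longrightarrow> r i \<in> carrier R) \<Longrightarrow>
    ps_has_prod R (\<lambda>i. ps_subst_power R i (lam (r i))) P \<longleftrightarrow> P = lam_prod r"
  unfolding lam_prod_def by (intro ps_has_prod_iff_tprod multipliable_lam)

section \<open>Uniqueness and existence of expansions\<close>

text \<open>The new factor is 1 + a t^(n+1) + ..., so it shifts coefficient n + 1 by exactly its
  parameter. This triangularity drives both uniqueness and existence.\<close>

lemma mult_subst_power_lam_top:
  assumes "P \<in> carrier (ps_unit_group R)" "a \<in> carrier R"
  shows "ps_mult R P (ps_subst_power R (Suc n) (lam a)) (Suc n) = P (Suc n) \<oplus> a"
proof -
  have S: "ps_subst_power R (Suc n) (lam a) \<in> carrier (ps_unit_group R)"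
    using assms by (simp add: ps_subst_power_closed lam_closed)
  have "ps_mult R P (ps_subst_power R (Suc n) (lam a)) (Suc n) =
      P (Suc n) \<oplus> ps_subst_power R (Suc n) (lam a) (Suc n)"
    using assms S
    by (intro ps_mult_top_coeffs unit_group_range unit_group_zero)
       (auto simp: ps_subst_power_def dest: dvd_imp_le)
  also have "ps_subst_power R (Suc n) (lam a) (Suc n) = a"
    using lam_coeff_one[OF assms(2)] by (simp add: ps_subst_power_def)
  finally show ?thesis .
qed

text \<open>If the parameters agree below i, the products of the first i - 1 factors coincide, and
  coefficient i then determines the i-th parameter by cancellation.\<close>

lemma lam_prod_inject:
  assumes r: "\<And>i. 1 \<le> i \<Longrightarrow> r i \<in> carrier R" and s: "\<And>i. 1 \<le> i \<Longrightarrow> s i \<in> carrier R"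
    and eq: "lam_prod r = lam_prod s" and "1 \<le> i"
  shows "r i = s i"
  using \<open>1 \<le> i\<close>
proof (induction i rule: less_induct)
  case (less i)
  let ?F = "\<lambda>r i. ps_subst_power R i (lam (r i))"
  obtain n where n: "i = Suc n"
    using less.prems by (cases i) auto
  have "ps_partial_prod R (?F r) n = ps_partial_prod R (?F s) n"
  proof -
    have "r j = s j" if "1 \<le> j" "j \<le> n" for j
      using less.IH that n by simp
    then have "ps_partial_prod R (?F r) k = ps_partial_prod R (?F s) k" if "k \<le> n" for k
      using that by (induction k) auto
    then show ?thesis by simp
  qed
  moreover have cl: "ps_partial_prod R (?F r) n \<in> carrier (ps_unit_group R)"
    using r by (intro ps_partial_prod_closed ps_subst_power_closed lam_closed) auto
  moreover have "ps_partial_prod R (?F r) (Suc n) (Suc n) = ps_partial_prod R (?F s) (Suc n) (Suc n)"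
    using fun_cong[OF eq, of "Suc n"] by (simp only: lam_prod_def ps_tprod_def)
  ultimately have "ps_partial_prod R (?F r) n (Suc n) \<oplus> r (Suc n) = ps_partial_prod R (?F r) n (Suc n) \<oplus> s (Suc n)"
    using r[of "Suc n"] s[of "Suc n"] by (simp add: mult_subst_power_lam_top)
  then show ?case
    using r[of "Suc n"] s[of "Suc n"] cl by (simp add: n unit_group_coeff)
qed

text \<open>Greedy expansion: the parameter of each new factor is the remaining error in the
  coefficient that the factor is the first to affect.\<close>

primrec lam_approx :: "'a pseries \<Rightarrow> nat \<Rightarrow> 'a pseries" where
  "lam_approx A 0 = ps_one R"
| "lam_approx A (Suc n) =
     ps_mult R (lam_approx A n) (ps_subst_power R (Suc n) (lam (A (Suc n) \<ominus> lam_approx A n (Suc n))))"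

lemma lam_prod_surj:
  assumes A: "A \<in> carrier (ps_unit_group R)"
  obtains r where "\<And>i. r i \<in> carrier R" "A = lam_prod r"
proof -
  \<comment> \<open>The correction made in step i, which starts from the approximation with i - 1
    factors.\<close>
  define r where "r i = A i \<ominus> lam_approx A (i - 1) i" for i
  have P: "lam_approx A n \<in> carrier (ps_unit_group R)" for n
  proof (induction n)
    case (Suc n)
    then show ?case
      using A by (simp add: lam_closed ps_subst_power_closed unit_group_coeff)
  qed simp
  have r: "r i \<in> carrier R" for i
    using A P by (simp add: r_def unit_group_coeff)
  have approx: "ps_partial_prod R (\<lambda>i. ps_subst_power R i (lam (r i))) n = lam_approx A n" for n
    by (induction n) (simp_all add: r_def)
  have "lam_approx A n n = A n" for n
  proof (cases n)
    case 0
    then show ?thesis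
      using A by (simp add: ps_one_def unit_group_zero)
  next
    case (Suc m)
    then show ?thesis
      using P[of m] A by (simp add: mult_subst_power_lam_top unit_group_coeff a_minus_def a_lcomm[of "lam_approx A m (Suc m)"] r_neg)
  qed
  then have "A = lam_prod r"
    by (simp add: lam_prod_def ps_tprod_def approx)
  with r that show thesis by blast
qed

section \<open>Powers of expansions and their behaviour under substitution\<close>

text \<open>Uniqueness of expansions makes the description in \<open>ps_power\<close> definite: any
  admissible \<open>s\<close> equals \<open>r\<close> at all indices from 1 on.\<close>

lemma ps_power_lam_prod:
  assumes r: "\<And>i. 1 \<le> i \<Longrightarrow> r i \<in> carrier R" and m: "m \<in> carrier R"
  shows "ps_power R lam (lam_prod r) m = lam_prod (\<lambda>i. m \<otimes> r i)"
  unfolding ps_power_def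
proof (rule the_equality)
  show "\<exists>s. (\<forall>i\<ge>1. s i \<in> carrier R) \<and>
     ps_has_prod R (\<lambda>i. ps_subst_power R i (lam (s i))) (lam_prod r) \<and>
     ps_has_prod R (\<lambda>i. ps_subst_power R i (lam (m \<otimes> s i))) (lam_prod (\<lambda>i. m \<otimes> r i))"
    using r m by (intro exI[of _ r]) (simp add: has_prod_lam_iff)
next
  fix B
  assume "\<exists>s. (\<forall>i\<ge>1. s i \<in> carrier R) \<and>
     ps_has_prod R (\<lambda>i. ps_subst_power R i (lam (s i))) (lam_prod r) \<and>
     ps_has_prod R (\<lambda>i. ps_subst_power R i (lam (m \<otimes> s i))) B"
  then obtain s where s: "\<And>i. 1 \<le> i \<Longrightarrow> s i \<in> carrier R"
    and prods: "ps_has_prod R (\<lambda>i. ps_subst_power R i (lam (s i))) (lam_prod r)"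
      "ps_has_prod R (\<lambda>i. ps_subst_power R i (lam (m \<otimes> s i))) B"
    by blast
  have B: "B = lam_prod (\<lambda>i. m \<otimes> s i)"
    using prods(2) s m by (subst (asm) has_prod_lam_iff) auto
  have "lam_prod r = lam_prod s"
    using prods(1) s by (subst (asm) has_prod_lam_iff) auto
  then have "r i = s i" if "1 \<le> i" for i
    using that by (intro lam_prod_inject[of r s] r s)
  then show "B = lam_prod (\<lambda>i. m \<otimes> r i)"
    unfolding B by (intro lam_prod_cong) simp
qed

text \<open>A gap filled with 1 is a factor with parameter 0, so a dilated expansion is again an
  expansion.\<close>

lemma dilate_lam:
  assumes "1 \<le> n" "1 \<le> j"
  shows "ps_dilate n (\<lambda>i. ps_subst_power R i (lam (b i))) j =
    ps_subst_power R j (lam (if n dvd j then b (j div n) else \<zero>))"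
proof (cases "n dvd j")
  case True
  moreover from this assms have "1 \<le> j div n"
    by (auto elim!: dvdE)
  ultimately show ?thesis
    using assms by (simp add: ps_dilate_def ps_subst_power_subst_power)
next
  case False
  then show ?thesis
    using assms by (simp add: ps_dilate_def subst_power_lam_zero)
qed

lemma ps_subst_power_lam_prod:
  assumes n: "1 \<le> n" and b: "\<And>i. b i \<in> carrier R"
  shows "ps_subst_power R n (lam_prod b) = lam_prod (\<lambda>j. if n dvd j then b (j div n) else \<zero>)"
proof -
  have "ps_subst_power R n (lam_prod b) = ps_tprod R (ps_dilate n (\<lambda>i. ps_subst_power R i (lam (b i))))"
    unfolding lam_prod_def using assms by (intro ps_subst_power_tprod multipliable_lam)
  also have "\<dots> = lam_prod (\<lambda>j. if n dvd j then b (j div n) else \<zero>)"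
    unfolding lam_prod_def by (intro ps_tprod_cong dilate_lam n)
  finally show ?thesis .
qed

text \<open>The power multiplies parameters by \<open>m\<close>, the substitution only moves them
  and inserts zeros, so the two commute.\<close>

lemma ps_power_subst_power_lam_prod:
  assumes n: "1 \<le> n" and b: "\<And>i. b i \<in> carrier R" and m: "m \<in> carrier R"
  shows "ps_power R lam (ps_subst_power R n (lam_prod b)) m = ps_subst_power R n (lam_prod (\<lambda>i. m \<otimes> b i))"
proof -
  have "ps_power R lam (ps_subst_power R n (lam_prod b)) m =
      lam_prod (\<lambda>j. m \<otimes> (if n dvd j then b (j div n) else \<zero>))"
    using assms by (simp add: ps_subst_power_lam_prod ps_power_lam_prod)
  also have "\<dots> = lam_prod (\<lambda>j. if n dvd j then m \<otimes> b (j div n) else \<zero>)"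
    using m by (intro lam_prod_cong) simp
  finally show ?thesis
    using assms by (simp add: ps_subst_power_lam_prod)
qed

section \<open>Collecting the product over all substitutions into divisor sums\<close>

text \<open>Dirichlet convolution with the constant 1, indexed by the codivisor \<open>n\<close>
  because \<open>n\<close> is the exponent of the substitution that contributes to position
  \<open>j\<close>.\<close>

definition divisor_sum :: "(nat \<Rightarrow> 'a) \<Rightarrow> nat \<Rightarrow> 'a" where
  "divisor_sum b j = (\<Oplus>n\<in>{1..j}. if n dvd j then b (j div n) else \<zero>)"

lemma divisor_sum_closed: "(\<And>i. b i \<in> carrier R) \<Longrightarrow> divisor_sum b j \<in> carrier R"
  unfolding divisor_sum_def by (intro finsum_closed) auto

lemma divisor_sum_ldistr:
  assumes "\<And>i. b i \<in> carrier R" "m \<in> carrier R"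
  shows "divisor_sum (\<lambda>i. m \<otimes> b i) j = m \<otimes> divisor_sum b j"
proof -
  have "m \<otimes> divisor_sum b j = (\<Oplus>n\<in>{1..j}. m \<otimes> (if n dvd j then b (j div n) else \<zero>))"
    unfolding divisor_sum_def using assms by (intro finsum_rdistr) auto
  also have "\<dots> = divisor_sum (\<lambda>i. m \<otimes> b i) j"
    unfolding divisor_sum_def using assms by (intro finsum_cong') auto
  finally show ?thesis ..
qed

text \<open>Position j of the double product receives the parameter b (j / n) from each n dividing
  j, and additivity of \<open>lam\<close> merges these factors into one.\<close>

lemma tprod_subst_power_lam_prod:
  assumes b: "\<And>i. b i \<in> carrier R"
  shows "ps_tprod R (\<lambda>n. ps_subst_power R n (lam_prod b)) = lam_prod (divisor_sum b)"
proof -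
  let ?E = "\<lambda>n. ps_dilate n (\<lambda>i. ps_subst_power R i (lam (b i)))"
  have mult: "ps_multipliable R (?E n)" if "1 \<le> n" for n
    using that b by (intro ps_multipliable_dilate multipliable_lam)
  have sub: "ps_subst_power R n (lam_prod b) = ps_tprod R (?E n)" if "1 \<le> n" for n
    unfolding lam_prod_def using that b by (intro ps_subst_power_tprod multipliable_lam)
  have fin: "finprod (ps_unit_group R) (\<lambda>n. ?E n j) {1..j} = ps_subst_power R j (lam (divisor_sum b j))"
    if "1 \<le> j" for j
  proof -
    have "finprod (ps_unit_group R) (\<lambda>n. ?E n j) {1..j} =
        finprod (ps_unit_group R) (\<lambda>n. ps_subst_power R j (lam (if n dvd j then b (j div n) else \<zero>))) {1..j}"
      using that b by (intro U.finprod_cong') (auto simp: dilate_lam intro!: ps_subst_power_closed lam_closed)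
    also have "\<dots> = ps_subst_power R j (lam (divisor_sum b j))"
      unfolding divisor_sum_def using that b by (intro subst_power_lam_finsum[symmetric]) auto
    finally show ?thesis .
  qed
  have "ps_tprod R (\<lambda>n. ps_subst_power R n (lam_prod b)) = ps_tprod R (\<lambda>n. ps_tprod R (?E n))"
    by (intro ps_tprod_cong sub)
  also have "\<dots> = ps_tprod R (\<lambda>j. finprod (ps_unit_group R) (\<lambda>n. ?E n j) {1..j})"
  proof (rule ps_tprod_swap)
    have "ps_multipliable R (\<lambda>n. ps_subst_power R n (lam_prod b))"
      using b by (intro ps_multipliable_subst_power lam_prod_closed)
    then show "ps_multipliable R (\<lambda>n. ps_tprod R (?E n))"
      using sub by (simp add: ps_multipliable_def)
    have "ps_multipliable R (\<lambda>j. ps_subst_power R j (lam (divisor_sum b j)))"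
      using b by (intro multipliable_lam divisor_sum_closed)
    then show "ps_multipliable R (\<lambda>j. finprod (ps_unit_group R) (\<lambda>n. ?E n j) {1..j})"
      using fin by (simp add: ps_multipliable_def)
  \<comment> \<open>The hypothesis \<open>low\<close> holds because n > j \<ge> 1 cannot divide
    j.\<close>
  qed (use mult in \<open>auto simp: ps_dilate_def dest: dvd_imp_le\<close>)
  also have "\<dots> = lam_prod (divisor_sum b)"
    unfolding lam_prod_def by (intro ps_tprod_cong fin)
  finally show ?thesis .
qed

lemma lam_prod_single:
  assumes "m \<in> carrier R"
  shows "lam_prod (\<lambda>i. if i = 1 then m else \<zero>) = lam m"
proof
  fix n
  let ?F = "\<lambda>i. ps_subst_power R i (lam (if i = 1 then m else \<zero>))"
  have *: "ps_partial_prod R ?F (Suc k) = lam m" for k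
  proof (induction k)
    case 0
    then show ?case
      using assms by (simp add: lam_closed ps_subst_power_def)
  next
    case (Suc k)
    have "ps_partial_prod R ?F (Suc (Suc k)) = ps_mult R (lam m) (ps_one R)"
      using Suc by (simp add: subst_power_lam_zero del: One_nat_def)
    then show ?case
      using assms by (simp add: lam_closed)
  qed
  show "lam_prod (\<lambda>i. if i = 1 then m else \<zero>) n = lam m n"
  \<comment> \<open>The empty partial product is 1, not \<open>lam m\<close>, so coefficient 0 is
    compared separately.\<close>
  proof (cases n)
    case 0
    then show ?thesis
      using assms by (simp add: lam_prod_def ps_tprod_def ps_one_def unit_group_zero lam_closed)
  next
    case (Suc k)
    then show ?thesis
      using * by (simp only: lam_prod_def ps_tprod_def)
  qed
qed

text \<open>\<open>G\<close> stands for 1/(1 - t) and the hypothesis \<open>one\<close> for Euler's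
  product.\<close>

lemma has_prod_power_subst_power:
  assumes G: "G \<in> carrier (ps_unit_group R)"
    and one: "lam \<one> = ps_tprod R (\<lambda>n. ps_subst_power R n G)"
    and m: "m \<in> carrier R"
  shows "ps_has_prod R (\<lambda>n. ps_power R lam (ps_subst_power R n G) m) (lam m)"
proof -
  obtain a where a: "\<And>i. a i \<in> carrier R" and G_eq: "G = lam_prod a"
    using lam_prod_surj[OF G] by blast
  \<comment> \<open>Both sides expand \<open>lam \<one>\<close>; uniqueness then yields the divisor
    sums of \<open>a\<close> without computing \<open>a\<close> itself.\<close>
  have "lam_prod (divisor_sum a) = lam_prod (\<lambda>i. if i = 1 then \<one> else \<zero>)"
    using one a by (simp only: G_eq tprod_subst_power_lam_prod lam_prod_single one_closed)
  then have delta: "divisor_sum a i = (if i = 1 then \<one> else \<zero>)" if "1 \<le> i" for i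
    using a that by (intro lam_prod_inject) (auto intro: divisor_sum_closed)
  let ?B = "lam_prod (\<lambda>i. m \<otimes> a i)"
  have "ps_tprod R (\<lambda>n. ps_subst_power R n ?B) = lam_prod (divisor_sum (\<lambda>i. m \<otimes> a i))"
    using a m by (intro tprod_subst_power_lam_prod) simp
  also have "\<dots> = lam_prod (\<lambda>i. if i = 1 then m else \<zero>)"
    using a m delta by (intro lam_prod_cong) (simp add: divisor_sum_ldistr)
  also have "\<dots> = lam m"
    using m by (rule lam_prod_single)
  finally have "ps_has_prod R (\<lambda>n. ps_subst_power R n ?B) (lam m)"
    using a m by (subst ps_has_prod_iff_tprod) (simp_all add: ps_multipliable_subst_power lam_prod_closed)
  moreover have "ps_power R lam (ps_subst_power R n G) m = ps_subst_power R n ?B" if "1 \<le> n" for n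
    using that a m by (simp add: G_eq ps_power_subst_power_lam_prod)
  ultimately show ?thesis
    by (subst ps_has_prod_cong)
qed

end

section \<open>Euler's product for the partition numbers\<close>

text \<open>Their numbers are the coefficients of the N-th partial product in Euler's
  formula.\<close>

definition bounded_partitions :: "nat \<Rightarrow> nat \<Rightarrow> nat multiset set" where
  "bounded_partitions N k = {p. 0 \<notin># p \<and> (\<forall>x\<in>#p. x \<le> N) \<and> sum_mset p = k}"

lemma bounded_partitions_0: "bounded_partitions 0 k = (if k = 0 then {{#}} else {})"
proof -
  have "0 \<notin># p \<and> (\<forall>x\<in>#p. x \<le> 0) \<longleftrightarrow> p = {#}" for p :: "nat multiset"
    by (metis empty_iff le_zero_eq multiset_nonemptyE set_mset_empty)
  then have "bounded_partitions 0 k = {p. p = {#} \<and> sum_mset p = k}"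
    unfolding bounded_partitions_def by metis
  then show ?thesis
    by auto
qed

text \<open>Either the part Suc N is absent, or one copy is removed. The bound stays Suc N in the
  second case, since further copies may remain.\<close>

lemma bounded_partitions_Suc:
  "bounded_partitions (Suc N) k = bounded_partitions N k \<union>
    (if Suc N \<le> k then add_mset (Suc N) ` bounded_partitions (Suc N) (k - Suc N) else {})"
    (is "?L = ?A \<union> ?B")
proof
  show "?L \<subseteq> ?A \<union> ?B"
  proof
    fix p assume p: "p \<in> ?L"
    show "p \<in> ?A \<union> ?B"
    proof (cases "Suc N \<in># p")
      case True
      then obtain q where q: "p = add_mset (Suc N) q"
        by (metis insert_DiffM)
      with p have "q \<in> bounded_partitions (Suc N) (k - Suc N)" "Suc N \<le> k"
        by (auto simp: bounded_partitions_def)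
      with q show ?thesis by simp
    next
      case False
      with p have "p \<in> ?A"
        by (auto simp: bounded_partitions_def) (metis le_SucE)
      then show ?thesis ..
    qed
  qed
  show "?A \<union> ?B \<subseteq> ?L"
    by (auto simp: bounded_partitions_def split: if_splits)
qed

lemma finite_bounded_partitions: "finite (bounded_partitions N k)"
proof (induction N arbitrary: k)
  case 0
  then show ?case by (simp add: bounded_partitions_0)
next
  case (Suc N)
  note fin = this
  show ?case
  \<comment> \<open>The second family in the recursion keeps the bound and lowers only the sum,
    hence an inner induction on k.\<close>
  proof (induction k rule: less_induct)
    case (less k)
    with fin show ?case
      by (subst bounded_partitions_Suc) auto
  qed
qed

text \<open>With Q(N) the generating series of these numbers, this is the coefficient form of (1 -
  t^(N+1)) Q(N+1) = Q(N).\<close>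

lemma card_bounded_partitions_Suc:
  "card (bounded_partitions (Suc N) k) = card (bounded_partitions N k) +
    (if Suc N \<le> k then card (bounded_partitions (Suc N) (k - Suc N)) else 0)"
proof -
  have "bounded_partitions N k \<inter> add_mset (Suc N) ` bounded_partitions (Suc N) (k - Suc N) = {}"
  proof -
    have "add_mset (Suc N) q \<notin> bounded_partitions N k" for q
      unfolding bounded_partitions_def by simp
    then show ?thesis by blast
  qed
  then show ?thesis
    by (subst bounded_partitions_Suc)
       (simp add: card_Un_disjoint finite_bounded_partitions card_image inj_on_def)
qed

lemma card_bounded_partitions_zero: "card (bounded_partitions N 0) = 1"
  by (induction N) (simp_all add: bounded_partitions_0 card_bounded_partitions_Suc)

text \<open>No part exceeds the sum of all parts.\<close>

lemma card_bounded_partitions_eq_partition_number: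
  "card (bounded_partitions k k) = partition_number k"
proof -
  have "x \<le> sum_mset p" if "x \<in># p" for x and p :: "nat multiset"
    using that by (metis insert_DiffM le_add1 sum_mset.add_mset)
  then have "bounded_partitions k k = {p. 0 \<notin># p \<and> sum_mset p = k}"
    by (auto simp: bounded_partitions_def)
  then show ?thesis
    by (simp add: partition_number_def)
qed

section \<open>The series 1/(1 - t^n) and their product\<close>

context cring
begin

lemma ps_one_minus_power_closed:
  "1 \<le> n \<Longrightarrow> ps_one_minus_power R n \<in> carrier (ps_unit_group R)"
  by (auto simp: ps_one_minus_power_def ps_unit_group_def)

lemma ps_mult_one_minus_power:
  assumes "1 \<le> n" "range f \<subseteq> carrier R"
  shows "ps_mult R f (ps_one_minus_power R n) k = (if n \<le> k then f k \<ominus> f (k - n) else f k)"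
proof -
  have cl: "f i \<in> carrier R" for i
    using assms by auto
  have "ps_mult R f (ps_one_minus_power R n) k =
      (\<Oplus>i\<in>(if n \<le> k then {k, k - n} else {k}). f i \<otimes> ps_one_minus_power R n (k - i))"
    unfolding ps_mult_def
    by (rule add.finprod_mono_neutral_cong_right) (use cl in \<open>auto simp: ps_one_minus_power_def split: if_splits\<close>)
  also have "\<dots> = (if n \<le> k then f k \<ominus> f (k - n) else f k)"
    using assms cl by (auto simp: ps_one_minus_power_def a_minus_def r_minus)
  finally show ?thesis .
qed

lemma ps_subst_power_one_minus_power:
  "1 \<le> n \<Longrightarrow> ps_subst_power R n (ps_one_minus_power R 1) = ps_one_minus_power R n"
  by (auto simp: ps_subst_power_def ps_one_minus_power_def fun_eq_iff elim!: dvdE)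

text \<open>Substitution of t^n is a group homomorphism, so it commutes with inversion.\<close>

lemma ps_inverse_one_minus_power:
  assumes "1 \<le> n"
  shows "ps_inverse R (ps_one_minus_power R n) =
    ps_subst_power R n (inv\<^bsub>ps_unit_group R\<^esub> (ps_one_minus_power R 1))"
proof -
  interpret h: group_hom "ps_unit_group R" "ps_unit_group R" "ps_subst_power R n"
    using assms by (rule ps_subst_power_hom)
  show ?thesis
    using assms ps_one_minus_power_closed[of 1]
    by (simp add: h.hom_inv ps_subst_power_one_minus_power[simplified] ps_inverse_eq_m_inv ps_one_minus_power_closed)
qed

lemma ps_partial_prod_inverse_one_minus_power:
  "ps_partial_prod R (\<lambda>n. inv\<^bsub>ps_unit_group R\<^esub> (ps_one_minus_power R n)) N =
    (\<lambda>k. [card (bounded_partitions N k)] \<cdot> \<one>)"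
proof (induction N)
  case 0
  show ?case
    by (auto simp: ps_one_def bounded_partitions_0)
next
  case (Suc N)
  let ?Q = "\<lambda>N k. [card (bounded_partitions N k)] \<cdot> \<one>"
  have Q: "?Q N \<in> carrier (ps_unit_group R)" for N
    by (auto simp: ps_unit_group_def card_bounded_partitions_zero)
  have D: "ps_one_minus_power R (Suc N) \<in> carrier (ps_unit_group R)"
    by (simp add: ps_one_minus_power_closed)
  \<comment> \<open>The recursion is checked with the denominator multiplied out; dividing in the
    group then gives the new partial product.\<close>
  have "ps_mult R (?Q (Suc N)) (ps_one_minus_power R (Suc N)) = ?Q N"
  proof
    fix k
    have "a \<oplus> b \<ominus> b = a" if "a \<in> carrier R" "b \<in> carrier R" for a b
      using that by (simp add: a_minus_def a_assoc r_neg)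
    then show "ps_mult R (?Q (Suc N)) (ps_one_minus_power R (Suc N)) k = ?Q N k"
      using unit_group_range[OF Q, of "Suc N"] card_bounded_partitions_Suc[of N k]
      by (simp add: ps_mult_one_minus_power add.nat_pow_mult[symmetric])
  qed
  then have "?Q (Suc N) = ps_mult R (?Q N) (inv\<^bsub>ps_unit_group R\<^esub> (ps_one_minus_power R (Suc N)))"
    using U.inv_solve_right[OF Q[of "Suc N"] Q[of N] D] by metis
  then show ?case
    by (simp add: Suc)
qed

lemma ps_tprod_inverse_one_minus_power:
  "ps_tprod R (\<lambda>n. inv\<^bsub>ps_unit_group R\<^esub> (ps_one_minus_power R n)) = (\<lambda>k. [partition_number k] \<cdot> \<one>)"
  by (simp add: ps_tprod_def ps_partial_prod_inverse_one_minus_power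
      card_bounded_partitions_eq_partition_number)

end

section \<open>The formula in 2-lambda-rings and its application to \<open>K0\<close>\<close>

lemma two_lambda_ring_pre_lambda_ring:
  assumes "two_lambda_ring R S"
  shows "pre_lambda_ring R (\<lambda>a k. S k a)"
proof -
  interpret cring R
    using assms by (simp add: two_lambda_ring_def)
  show ?thesis
    by unfold_locales (use assms in \<open>auto simp: two_lambda_ring_def ps_unit_group_def ps_mult_def\<close>)
qed

lemma two_lambda_ring_has_prod:
  assumes S: "two_lambda_ring R S" and m: "m \<in> carrier R"
  shows "ps_has_prod R (\<lambda>n. ps_power R (\<lambda>a k. S k a) (ps_inverse R (ps_one_minus_power R n)) m)
    (\<lambda>k. S k m)"
proof -
  interpret pre_lambda_ring R "\<lambda>a k. S k a"
    using S by (rule two_lambda_ring_pre_lambda_ring)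
  let ?G = "inv\<^bsub>ps_unit_group R\<^esub> (ps_one_minus_power R 1)"
  have G: "?G \<in> carrier (ps_unit_group R)"
    by (simp add: ps_one_minus_power_closed)
  have inverse: "ps_inverse R (ps_one_minus_power R n) = ps_subst_power R n ?G" if "1 \<le> n" for n
    using that by (rule ps_inverse_one_minus_power)
  \<comment> \<open>This is where the value of \<open>S k\<close> at 1, the k-th partition number,
    enters: it identifies \<lambda> of 1 with Euler's product.\<close>
  have "(\<lambda>k. S k \<one>\<^bsub>R\<^esub>) = ps_tprod R (\<lambda>n. inv\<^bsub>ps_unit_group R\<^esub> (ps_one_minus_power R n))"
    using S by (simp add: two_lambda_ring_def ps_tprod_inverse_one_minus_power)
  also have "\<dots> = ps_tprod R (\<lambda>n. ps_subst_power R n ?G)"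
    using inverse by (intro ps_tprod_cong) (metis ps_inverse_eq_m_inv ps_one_minus_power_closed)
  finally have "ps_has_prod R (\<lambda>n. ps_power R (\<lambda>a k. S k a) (ps_subst_power R n ?G) m) (\<lambda>k. S k m)"
    using G m by (intro has_prod_power_subst_power)
  then show ?thesis
    by (subst ps_has_prod_cong) (simp_all add: inverse)
qed

theorem theorem1p2:
  fixes Sym :: "nat \<Rightarrow> ('k::field_char_0) K0_elem \<Rightarrow> 'k K0_elem"
    and M :: "'k K0_elem"
  assumes Sym: "Sym_operations Sym"
    and M: "M \<in> carrier K0"
  shows "ps_has_prod K0
           (\<lambda>n. ps_power K0 (Z_cat Sym) (ps_inverse K0 (ps_one_minus_power K0 n)) M)
           (Z_cat Sym M)"
proof -
  have "two_lambda_ring K0 Sym"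
    using Sym by (simp add: Sym_operations_def)
  moreover have "Z_cat Sym = (\<lambda>a k. Sym k a)"
    by (simp add: Z_cat_def fun_eq_iff)
  ultimately show ?thesis
    using two_lambda_ring_has_prod M by metis
qed

end
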